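(* Let $\mathcal{E}_1,\mathcal{E}_2$ be unital qubit channels in diagonal (Pauli) form with diagonal entries $(1,\lambda_1,\lambda_2,\lambda_3)$ and $(1,\lambda'_1,\lambda'_2,\lambda'_3)$, respectively. Suppose that $\mathcal{E}_1^2=\mathcal{E}_1\circ\mathcal{E}_1$ and $\mathcal{E}_2^2=\mathcal{E}_2\circ\mathcal{E}_2$ are entanglement-breaking, i.e. $\sum_{m=1}^3\lambda_m^2\le1$ and $\sum_{n=1}^3{\lambda'_n}^2\le1$. Then $\mathcal{E}_1\otimes\mathcal{E}_2$ is an entanglement-annihilating channel.
   Context: A qubit channel is a completely positive trace-preserving linear map on $M_2(\mathbb{C})$; it is unital if it fixes the identity $I$. A unital qubit channel $\mathcal{E}$ is in diagonal (Pauli) form with diagonal entries $(1,\lambda_1,\lambda_2,\lambda_3)$ if there is a basis $\{\sigma_0=I,\sigma_1,\sigma_2,\sigma_3\}$ of self-adjoint operators on $\mathbb{C}^2$ with $\mathrm{tr}[\sigma_j\sigma_k]=2\delta_{jk}$ such that $\mathcal{E}[I]=I$ and $\mathcal{E}[\sigma_m]=\lambda_m\sigma_m$ for $m=1,2,3$, with real (possibly negative) $\lambda_m$. The bases $\{\sigma_m\}$ for $\mathcal{E}_1$ and $\{\sigma'_n\}$ for $\mathcal{E}_2$ may be different. A state is a positive semidefinite operator of trace one. A two-qubit channel is called entanglement-annihilating (EA) if it maps every state on $\mathbb{C}^2\otimes\mathbb{C}^2$ to a state that is separable with respect to the partition qubit 1 | qubit 2. A channel $\mathcal{F}$ is called entanglement-breaking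 (EB) if for every finite-dimensional ancilla and every state $\rho$ of system plus ancilla, $(\mathcal{F}\otimes\mathcal{I}_{\rm anc})[\rho]$ is separable with respect to the partition system | ancilla, where $\mathcal{I}_{\rm anc}$ is the identity channel on the ancilla. *)

theory Defs
  imports "Jordan_Normal_Form.Schur_Decomposition"
begin

text \<open>
  Operators on a d-dimensional Hilbert space are elements of \<open>carrier_mat d d\<close>, and
  superoperators are functions on matrices of which only the values on \<open>carrier_mat d d\<close>
  are ever used. Dimensions are natural numbers rather than types, so that one can quantify
  over all finite-dimensional ancillas inside a definition.
\<close>

definition mat_trace :: "complex mat \<Rightarrow> complex" where
  "mat_trace A = (\<Sum>i<dim_row A. A $$ (i, i))"

definition self_adjoint :: "complex mat \<Rightarrow> bool" where
  "self_adjoint A \<longleftrightarrow> mat_adjoint A = A"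

text \<open>The order on \<^typ>\<open>complex\<close> is that of \<^theory>\<open>HOL-Library.Complex_Order\<close>: \<open>0 \<le> z\<close> means that
  \<open>z\<close> is real and nonnegative.\<close>

definition positive_semidefinite :: "nat \<Rightarrow> complex mat \<Rightarrow> bool" where
  "positive_semidefinite d A \<longleftrightarrow>
     A \<in> carrier_mat d d \<and> self_adjoint A \<and> (\<forall>v \<in> carrier_vec d. 0 \<le> (A *\<^sub>v v) \<bullet>c v)"

definition quantum_state :: "nat \<Rightarrow> complex mat \<Rightarrow> bool" where
  "quantum_state d \<rho> \<longleftrightarrow> positive_semidefinite d \<rho> \<and> mat_trace \<rho> = 1"

text \<open>Kronecker product: in \<open>m * n\<close> dimensions the index \<open>i * n + k\<close> stands for the product basis
  vector \<open>e\<^sub>i \<otimes> e\<^sub>k\<close>.\<close>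

definition tensor_mat :: "complex mat \<Rightarrow> complex mat \<Rightarrow> complex mat" where
  "tensor_mat A B = mat (dim_row A * dim_row B) (dim_col A * dim_col B)
     (\<lambda>(r, c). A $$ (r div dim_row B, c div dim_col B) * B $$ (r mod dim_row B, c mod dim_col B))"

definition linear_superoperator :: "nat \<Rightarrow> (complex mat \<Rightarrow> complex mat) \<Rightarrow> bool" where
  "linear_superoperator d F \<longleftrightarrow>
     (\<forall>A \<in> carrier_mat d d. F A \<in> carrier_mat d d) \<and>
     (\<forall>A \<in> carrier_mat d d. \<forall>B \<in> carrier_mat d d. F (A + B) = F A + F B) \<and>
     (\<forall>a. \<forall>A \<in> carrier_mat d d. F (a \<cdot>\<^sub>m A) = a \<cdot>\<^sub>m F A)"

definition matrix_unit :: "nat \<Rightarrow> nat \<Rightarrow> nat \<Rightarrow> complex mat" where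
  "matrix_unit d i j = mat d d (\<lambda>(r, c). if r = i \<and> c = j then 1 else 0)"

text \<open>The superoperator \<open>F \<otimes> G\<close>, given by its values on the product basis of matrix units;
  \<open>tensor_map_tensor_mat\<close> below shows that it sends \<open>A \<otimes> B\<close> to \<open>F A \<otimes> G B\<close>.\<close>

definition tensor_map ::
    "nat \<Rightarrow> nat \<Rightarrow> (complex mat \<Rightarrow> complex mat) \<Rightarrow> (complex mat \<Rightarrow> complex mat)
      \<Rightarrow> complex mat \<Rightarrow> complex mat" where
  "tensor_map m n F G X = mat (m * n) (m * n)
     (\<lambda>(r, c). \<Sum>i<m. \<Sum>j<m. \<Sum>k<n. \<Sum>l<n.
        X $$ (i * n + k, j * n + l) *
          tensor_mat (F (matrix_unit m i j)) (G (matrix_unit n k l)) $$ (r, c))"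

definition completely_positive :: "nat \<Rightarrow> (complex mat \<Rightarrow> complex mat) \<Rightarrow> bool" where
  "completely_positive d F \<longleftrightarrow>
     (\<forall>n X. positive_semidefinite (d * n) X \<longrightarrow>
        positive_semidefinite (d * n) (tensor_map d n F (\<lambda>Y. Y) X))"

definition trace_preserving :: "nat \<Rightarrow> (complex mat \<Rightarrow> complex mat) \<Rightarrow> bool" where
  "trace_preserving d F \<longleftrightarrow> (\<forall>A \<in> carrier_mat d d. mat_trace (F A) = mat_trace A)"

definition quantum_channel :: "nat \<Rightarrow> (complex mat \<Rightarrow> complex mat) \<Rightarrow> bool" where
  "quantum_channel d F \<longleftrightarrow>
     linear_superoperator d F \<and> completely_positive d F \<and> trace_preserving d F"

definition unital_channel :: "nat \<Rightarrow> (complex mat \<Rightarrow> complex mat) \<Rightarrow> bool" where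
  "unital_channel d F \<longleftrightarrow> quantum_channel d F \<and> F (1\<^sub>m d) = 1\<^sub>m d"

text \<open>The four operators are linearly independent, being orthogonal and nonzero for the
  Hilbert-Schmidt inner product, and hence a basis of the four-dimensional space
  \<open>carrier_mat 2 2\<close>. Only the values of \<open>l\<close> at 1, 2, 3 matter.\<close>

definition pauli_type_basis :: "(nat \<Rightarrow> complex mat) \<Rightarrow> bool" where
  "pauli_type_basis \<sigma> \<longleftrightarrow>
     \<sigma> 0 = 1\<^sub>m 2 \<and>
     (\<forall>j<4. \<sigma> j \<in> carrier_mat 2 2 \<and> self_adjoint (\<sigma> j)) \<and>
     (\<forall>j<4. \<forall>k<4. mat_trace (\<sigma> j * \<sigma> k) = (if j = k then 2 else 0))"

definition pauli_diagonal :: "(complex mat \<Rightarrow> complex mat) \<Rightarrow> (nat \<Rightarrow> real) \<Rightarrow> bool" where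
  "pauli_diagonal F l \<longleftrightarrow>
     (\<exists>\<sigma>. pauli_type_basis \<sigma> \<and> F (\<sigma> 0) = \<sigma> 0 \<and>
        (\<forall>m\<in>{1..3}. F (\<sigma> m) = complex_of_real (l m) \<cdot>\<^sub>m \<sigma> m))"

text \<open>Separable states with respect to the partition \<open>m | n\<close>: finite convex combinations of
  product states.\<close>

definition separable :: "nat \<Rightarrow> nat \<Rightarrow> complex mat \<Rightarrow> bool" where
  "separable m n \<rho> \<longleftrightarrow>
     (\<exists>(K::nat) p \<alpha> \<beta>.
        (\<forall>k<K. (0::real) \<le> p k \<and> quantum_state m (\<alpha> k) \<and> quantum_state n (\<beta> k)) \<and>
        (\<Sum>k<K. p k) = 1 \<and>
        \<rho> = mat (m * n) (m * n)
               (\<lambda>(r, c). \<Sum>k<K. complex_of_real (p k) * tensor_mat (\<alpha> k) (\<beta> k) $$ (r, c)))"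

text \<open>In both definitions below the input \<open>\<rho>\<close> is an arbitrary, possibly entangled, state; the case
  \<open>n = 0\<close> of the first is vacuous.\<close>

definition entanglement_breaking :: "nat \<Rightarrow> (complex mat \<Rightarrow> complex mat) \<Rightarrow> bool" where
  "entanglement_breaking d F \<longleftrightarrow>
     quantum_channel d F \<and>
     (\<forall>n \<rho>. quantum_state (d * n) \<rho> \<longrightarrow> separable d n (tensor_map d n F (\<lambda>Y. Y) \<rho>))"

definition entanglement_annihilating ::
    "nat \<Rightarrow> nat \<Rightarrow> (complex mat \<Rightarrow> complex mat) \<Rightarrow> bool" where
  "entanglement_annihilating m n \<Phi> \<longleftrightarrow>
     quantum_channel (m * n) \<Phi> \<and>
     (\<forall>\<rho>. quantum_state (m * n) \<rho> \<longrightarrow> separable m n (\<Phi> \<rho>))"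

lemma linear_superoperator_sum:
  assumes F: "linear_superoperator d F" and "finite S"
    and M: "\<And>s. s \<in> S \<Longrightarrow> M s \<in> carrier_mat d d"
  shows "F (mat d d (\<lambda>ij. \<Sum>s\<in>S. a s * M s $$ ij)) = mat d d (\<lambda>ij. \<Sum>s\<in>S. a s * F (M s) $$ ij)"
  using \<open>finite S\<close> M
proof (induction S rule: finite_induct)
  case empty
  have z: "mat d d (\<lambda>ij. 0) = (0::complex) \<cdot>\<^sub>m 0\<^sub>m d d" by (intro eq_matI) auto
  have c: "0\<^sub>m d d \<in> carrier_mat d d" "F (0\<^sub>m d d) \<in> carrier_mat d d"
    using F by (auto simp: linear_superoperator_def)
  have "F (mat d d (\<lambda>ij. 0)) = 0 \<cdot>\<^sub>m F (0\<^sub>m d d)"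
    unfolding z using F c(1) unfolding linear_superoperator_def by blast
  also have "\<dots> = mat d d (\<lambda>ij. 0)" using c by (intro eq_matI) auto
  finally show ?case by simp
next
  case (insert x S)
  let ?R = "mat d d (\<lambda>ij. \<Sum>s\<in>S. a s * M s $$ ij)"
  have Mx: "M x \<in> carrier_mat d d" and R: "?R \<in> carrier_mat d d" using insert.prems by auto
  have FM: "F (M x) \<in> carrier_mat d d" using F Mx by (auto simp: linear_superoperator_def)
  have "mat d d (\<lambda>ij. \<Sum>s\<in>insert x S. a s * M s $$ ij) = a x \<cdot>\<^sub>m M x + ?R"
    using insert.hyps Mx by (intro eq_matI) auto
  then have "F (mat d d (\<lambda>ij. \<Sum>s\<in>insert x S. a s * M s $$ ij)) = a x \<cdot>\<^sub>m F (M x) + F ?R"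
    using F Mx R by (simp add: linear_superoperator_def)
  also have "F ?R = mat d d (\<lambda>ij. \<Sum>s\<in>S. a s * F (M s) $$ ij)"
    using insert by simp
  also have "a x \<cdot>\<^sub>m F (M x) + \<dots> = mat d d (\<lambda>ij. \<Sum>s\<in>insert x S. a s * F (M s) $$ ij)"
    using insert.hyps FM by (intro eq_matI) auto
  finally show ?case .
qed

lemma linear_superoperator_matrix_units:
  assumes F: "linear_superoperator d F" and A: "A \<in> carrier_mat d d" and "r < d" "c < d"
  shows "F A $$ (r, c) = (\<Sum>i<d. \<Sum>j<d. A $$ (i, j) * F (matrix_unit d i j) $$ (r, c))"
proof -
  let ?S = "{..<d} \<times> {..<d}"
  have "A = mat d d (\<lambda>ij. \<Sum>s\<in>?S. A $$ s * matrix_unit d (fst s) (snd s) $$ ij)"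
  proof (rule eq_matI, goal_cases)
    case (1 i j)
    then have "(\<Sum>s\<in>?S. A $$ s * matrix_unit d (fst s) (snd s) $$ (i, j))
        = (\<Sum>s\<in>?S. if s = (i, j) then A $$ s else 0)"
      by (intro sum.cong) (auto simp: matrix_unit_def)
    with 1 show ?case by (simp add: sum.delta)
  qed (use A in auto)
  then have "F A = F (mat d d (\<lambda>ij. \<Sum>s\<in>?S. A $$ s * matrix_unit d (fst s) (snd s) $$ ij))"
    by (rule arg_cong)
  also have "\<dots> = mat d d (\<lambda>ij. \<Sum>s\<in>?S. A $$ s * F (matrix_unit d (fst s) (snd s)) $$ ij)"
    by (rule linear_superoperator_sum[OF F]) (auto simp: matrix_unit_def)
  finally show ?thesis using assms(3,4)
    by (simp add: sum.cartesian_product case_prod_beta)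
qed

lemma tensor_map_tensor_mat:
  assumes F: "linear_superoperator m F" and G: "linear_superoperator n G"
    and A: "A \<in> carrier_mat m m" and B: "B \<in> carrier_mat n n"
  shows "tensor_map m n F G (tensor_mat A B) = tensor_mat (F A) (G B)"
proof -
  have C: "F X \<in> carrier_mat m m" if "X \<in> carrier_mat m m" for X
    using F that by (auto simp: linear_superoperator_def)
  have D: "G X \<in> carrier_mat n n" if "X \<in> carrier_mat n n" for X
    using G that by (auto simp: linear_superoperator_def)
  have U: "matrix_unit d i j \<in> carrier_mat d d" for d i j by (simp add: matrix_unit_def)
  note dims = carrier_matD[OF C[OF A]] carrier_matD[OF D[OF B]] carrier_matD[OF A] carrier_matD[OF B]
    carrier_matD[OF C[OF U]] carrier_matD[OF D[OF U]]
  have lt: "i * n + k < m * n" if "i < m" "k < n" for i k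
  proof -
    have "i * n + k < Suc i * n" using that by simp
    also have "\<dots> \<le> m * n" using that by (intro mult_le_mono1) simp
    finally show ?thesis .
  qed
  show ?thesis
  proof (rule eq_matI, goal_cases)
    case (1 r c)
    then have rc: "r < m * n" "c < m * n" by (auto simp: tensor_mat_def dims)
    then have n: "0 < n" by (cases n) auto
    have dm: "r div n < m" "c div n < m" "r mod n < n" "c mod n < n"
      using rc n by (auto simp: less_mult_imp_div_less)
    have "tensor_map m n F G (tensor_mat A B) $$ (r, c) =
      (\<Sum>i<m. \<Sum>j<m. \<Sum>k<n. \<Sum>l<n. (A $$ (i, j) * F (matrix_unit m i j) $$ (r div n, c div n)) *
         (B $$ (k, l) * G (matrix_unit n k l) $$ (r mod n, c mod n)))"
      using rc lt by (auto simp: tensor_map_def tensor_mat_def dims intro!: sum.cong)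
    also have "\<dots> = (\<Sum>i<m. \<Sum>j<m. A $$ (i, j) * F (matrix_unit m i j) $$ (r div n, c div n)) *
         (\<Sum>k<n. \<Sum>l<n. B $$ (k, l) * G (matrix_unit n k l) $$ (r mod n, c mod n))"
      by (simp add: sum_distrib_left[symmetric] sum_distrib_right[symmetric])
    also have "\<dots> = F A $$ (r div n, c div n) * G B $$ (r mod n, c mod n)"
      using dm by (simp add: linear_superoperator_matrix_units[OF F A] linear_superoperator_matrix_units[OF G B])
    finally show ?case using rc by (simp add: tensor_mat_def dims)
  qed (auto simp: tensor_map_def tensor_mat_def dims)
qed

end

theory Submission
  imports Defs
begin

text \<open>
  A positive semidefinite matrix is a sum of rank-one ones, so it is enough to treat a pure input,
  whose Schmidt form is \<open>a e \<otimes> g + b f \<otimes> h\<close> with \<open>a, b \<ge> 0\<close>. Let \<open>s\<^sub>k\<close> and \<open>t\<^sub>k\<close> be the Pauli matrices in the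
  bases \<open>e, f\<close> and \<open>g, h\<close>, and let \<open>X\<^sub>k\<close>, \<open>Y\<^sub>k\<close> be their images under the two channels. With
  \<open>w = a\<^sup>2 + b\<^sup>2\<close> and \<open>d = a\<^sup>2 - b\<^sup>2\<close>, four times the output is
  \<open>w I \<otimes> I + d X\<^sub>3 \<otimes> I + d I \<otimes> Y\<^sub>3 + w X\<^sub>3 \<otimes> Y\<^sub>3 + 2ab X\<^sub>1 \<otimes> Y\<^sub>1 - 2ab X\<^sub>2 \<otimes> Y\<^sub>2\<close>.
  The last two terms become separable after borrowing \<open>2ab (\<bar>X\<^sub>1\<bar> \<bar>Y\<^sub>1\<bar> + \<bar>X\<^sub>2\<bar> \<bar>Y\<^sub>2\<bar>) I \<otimes> I\<close> from the first four,
  where \<open>\<bar>\<cdot>\<bar>\<close> is the length of the Bloch vector. What is left is diagonal in a product basis, hence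
  separable once it is nonnegative; this follows from the Cauchy-Schwarz inequality and
  \<open>\<Sum>k \<bar>X\<^sub>k\<bar>\<^sup>2 = \<Sum>m \<lambda>\<^sub>m\<^sup>2 \<le> 1\<close>, the invariance of the Hilbert-Schmidt norm of a channel
  under a change of basis.

  The square of a channel has nonnegative diagonal entries \<open>\<lambda>\<^sub>m\<^sup>2\<close>. If they add up to at most 1, it is a mixture
  of measure-and-prepare channels; conversely, the overlap of a separable state with the Bell state is
  at most 1/2, while that of the image of the Bell state is \<open>(1 + \<Sum>m \<lambda>\<^sub>m\<^sup>2) / 4\<close>.
\<close>

section \<open>Positive semidefinite kernels\<close>

text \<open>Kernels over an arbitrary index type let Choi matrices live on pairs of indices, and
  tensor products are reached by relabelling indices. In the order on \<open>complex\<close> the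
  inequality also says that the form is real; this is the source of hermiticity.\<close>

definition psd_kernel :: "'a set \<Rightarrow> ('a \<Rightarrow> 'a \<Rightarrow> complex) \<Rightarrow> bool" where
  "psd_kernel S A \<longleftrightarrow> (\<forall>x. 0 \<le> (\<Sum>r\<in>S. \<Sum>c\<in>S. cnj (x r) * A r c * x c))"

lemma psd_kernelD: "psd_kernel S A \<Longrightarrow> 0 \<le> (\<Sum>r\<in>S. \<Sum>c\<in>S. cnj (x r) * A r c * x c)"
  by (simp add: psd_kernel_def)

lemma psd_kernel_cong:
  "psd_kernel S A \<Longrightarrow> (\<And>r c. r \<in> S \<Longrightarrow> c \<in> S \<Longrightarrow> B r c = A r c) \<Longrightarrow> psd_kernel S B"
  by (simp add: psd_kernel_def cong: sum.cong)

lemma psd_kernel_transpose: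
  assumes "psd_kernel S A"
  shows "psd_kernel S (\<lambda>r c. A c r)"
  unfolding psd_kernel_def
proof
  fix x :: "_ \<Rightarrow> complex"
  have "(\<Sum>r\<in>S. \<Sum>c\<in>S. cnj (x r) * A c r * x c) = (\<Sum>c\<in>S. \<Sum>r\<in>S. cnj (cnj (x c)) * A c r * cnj (x r))"
    by (subst sum.swap) (simp add: mult_ac)
  then show "0 \<le> (\<Sum>r\<in>S. \<Sum>c\<in>S. cnj (x r) * A c r * x c)"
    using psd_kernelD[OF assms, of "\<lambda>r. cnj (x r)"] by simp
qed

lemma complex_mult_cnj_nonneg: "0 \<le> z * cnj z"
  by (simp add: complex_mult_cnj less_eq_complex_def)

lemma psd_kernel_rank_one: "psd_kernel S (\<lambda>r c. v r * cnj (v c))"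
  unfolding psd_kernel_def
proof
  fix x :: "_ \<Rightarrow> complex"
  have "(\<Sum>r\<in>S. \<Sum>c\<in>S. cnj (x r) * (v r * cnj (v c)) * x c)
      = (\<Sum>r\<in>S. cnj (x r) * v r) * cnj (\<Sum>r\<in>S. cnj (x r) * v r)"
    by (simp add: sum_product mult_ac)
  then show "0 \<le> (\<Sum>r\<in>S. \<Sum>c\<in>S. cnj (x r) * (v r * cnj (v c)) * x c)"
    by (simp only: complex_mult_cnj_nonneg)
qed

text \<open>This is the congruence of \<open>A\<close> by a 0-1 matrix. The map \<open>f\<close> may
  identify indices, so the test vector is pushed forward by summing over the fibres of
  \<open>f\<close>.\<close>

lemma psd_kernel_pullback:
  assumes A: "psd_kernel T A" and fin: "finite S" "finite T" and f: "f ` S \<subseteq> T"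
  shows "psd_kernel S (\<lambda>r c. A (f r) (f c))"
  unfolding psd_kernel_def
proof
  fix x :: "_ \<Rightarrow> complex"
  define y where "y t = (\<Sum>r | r \<in> S \<and> f r = t. x r)" for t
  have group: "(\<Sum>u\<in>T. \<Sum>c | c \<in> S \<and> f c = u. g c) = (\<Sum>c\<in>S. g c)" for g :: "_ \<Rightarrow> complex"
    by (rule sum.group[OF fin f])
  have "(\<Sum>r\<in>S. \<Sum>c\<in>S. cnj (x r) * A (f r) (f c) * x c)
      = (\<Sum>t\<in>T. \<Sum>r | r \<in> S \<and> f r = t. \<Sum>u\<in>T. \<Sum>c | c \<in> S \<and> f c = u. cnj (x r) * A (f r) (f c) * x c)"
    unfolding group ..
  also have "\<dots> = (\<Sum>t\<in>T. \<Sum>r | r \<in> S \<and> f r = t. \<Sum>u\<in>T. cnj (x r) * A t u * y u)"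
    by (intro sum.cong refl) (auto simp: y_def sum_distrib_left intro!: sum.cong)
  also have "\<dots> = (\<Sum>t\<in>T. \<Sum>u\<in>T. \<Sum>r | r \<in> S \<and> f r = t. cnj (x r) * A t u * y u)"
    by (rule sum.cong[OF refl], rule sum.swap)
  also have "\<dots> = (\<Sum>t\<in>T. \<Sum>u\<in>T. cnj (y t) * A t u * y u)"
    unfolding y_def cnj_sum sum_distrib_right[symmetric] ..
  finally show "0 \<le> (\<Sum>r\<in>S. \<Sum>c\<in>S. cnj (x r) * A (f r) (f c) * x c)"
    using psd_kernelD[OF A, of y] by simp
qed

text \<open>Test vectors that are constant in the summed index suffice. Combined with pullbacks and
  Schur products, this drives the complete positivity arguments below.\<close>

lemma psd_kernel_marginal:
  assumes "psd_kernel (S \<times> T) (\<lambda>(p, i) (q, j). K p i q j)"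
  shows "psd_kernel S (\<lambda>p q. \<Sum>i\<in>T. \<Sum>j\<in>T. K p i q j)"
  unfolding psd_kernel_def
proof
  fix x :: "_ \<Rightarrow> complex"
  have "(\<Sum>p\<in>S. \<Sum>q\<in>S. cnj (x p) * (\<Sum>i\<in>T. \<Sum>j\<in>T. K p i q j) * x q)
     = (\<Sum>p\<in>S. \<Sum>q\<in>S. \<Sum>i\<in>T. \<Sum>j\<in>T. cnj (x p) * K p i q j * x q)"
    by (simp add: sum_distrib_left sum_distrib_right)
  also have "\<dots> = (\<Sum>p\<in>S. \<Sum>i\<in>T. \<Sum>q\<in>S. \<Sum>j\<in>T. cnj (x p) * K p i q j * x q)"
    by (intro sum.cong refl) (rule sum.swap)
  finally show "0 \<le> (\<Sum>p\<in>S. \<Sum>q\<in>S. cnj (x p) * (\<Sum>i\<in>T. \<Sum>j\<in>T. K p i q j) * x q)"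
    using psd_kernelD[OF assms, of "\<lambda>(p, i). x p"]
    by (simp add: sum.cartesian_product' case_prod_beta)
qed

lemma psd_kernel_subset:
  assumes "psd_kernel T A" "S \<subseteq> T" "finite T"
  shows "psd_kernel S A"
  using psd_kernel_pullback[OF assms(1) finite_subset[OF assms(2,3)] assms(3), of "\<lambda>r. r"] assms(2) by simp

lemma psd_kernel_two_points:
  assumes "psd_kernel S A" "finite S" "r \<in> S" "c \<in> S" "r \<noteq> c"
  shows "0 \<le> A r r + z * A r c + cnj z * A c r + cnj z * z * A c c"
proof -
  have "psd_kernel {r, c} A" using assms by (intro psd_kernel_subset[OF assms(1)]) auto
  from psd_kernelD[OF this, of "\<lambda>i. if i = r then 1 else z"] show ?thesis
    using \<open>r \<noteq> c\<close> by (simp add: algebra_simps)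
qed

lemma psd_kernel_diag:
  assumes "psd_kernel S A" "finite S" "r \<in> S"
  shows "0 \<le> A r r"
proof -
  have "psd_kernel {r} A" using assms by (intro psd_kernel_subset[OF assms(1)]) auto
  from psd_kernelD[OF this, of "\<lambda>i. 1"] show ?thesis by simp
qed

lemma psd_kernel_hermitian:
  assumes A: "psd_kernel S A" "finite S" "r \<in> S" "c \<in> S"
  shows "A r c = cnj (A c r)"
proof (cases "r = c")
  case True
  then show ?thesis using psd_kernel_diag[OF A(1-3)] by (simp add: complex_eq_iff less_eq_complex_def)
next
  case False
  note Q = psd_kernel_two_points[OF A False]
  \<comment> \<open>At \<open>z = 1\<close> reality of the form makes the imaginary parts of the two
    entries opposite; at \<open>z = \<i>\<close> it makes their real parts equal.\<close>
  show ?thesis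
    using Q[of 1] Q[of \<i>] psd_kernel_diag[OF A(1-3)] psd_kernel_diag[OF A(1,2,4)]
    by (auto simp: complex_eq_iff less_eq_complex_def)
qed

text \<open>With \<open>A s s = 0\<close> the form on the indices \<open>r\<close> and
  \<open>s\<close> is affine in the coefficient at \<open>s\<close>, so a nonzero
  \<open>A r s\<close> would drive it below zero.\<close>

lemma psd_kernel_null_row:
  assumes A: "psd_kernel S A" "finite S" "r \<in> S" "s \<in> S" and "A s s = 0"
  shows "A r s = 0"
proof (rule ccontr)
  assume nz: "A r s \<noteq> 0"
  then have "r \<noteq> s" using \<open>A s s = 0\<close> by auto
  \<comment> \<open>This size brings the form to \<open>- A r r - 2\<close>, which is
    negative.\<close>
  define t where "t = (Re (A r r) + 1) / (cmod (A r s))\<^sup>2"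
  have "A s r = cnj (A r s)" by (rule psd_kernel_hermitian) fact+
  then have "0 \<le> A r r - 2 * (of_real t * (A r s * cnj (A r s)))"
    using psd_kernel_two_points[OF A \<open>r \<noteq> s\<close>, of "- of_real t * cnj (A r s)"] \<open>A s s = 0\<close>
    by (simp add: algebra_simps)
  also have "\<dots> = A r r - 2 * of_real (t * (cmod (A r s))\<^sup>2)"
    by (simp only: of_real_mult complex_norm_square)
  finally have "0 \<le> A r r - 2 * of_real (t * (cmod (A r s))\<^sup>2)" .
  moreover have "t * (cmod (A r s))\<^sup>2 = Re (A r r) + 1" using nz by (simp add: t_def)
  ultimately show False
    using psd_kernel_diag[OF A(1-3)] by (simp add: less_eq_complex_def)
qed

text \<open>Cholesky factorisation by induction on the index set: splitting off the row and column
  of \<open>s\<close> as a rank-one kernel leaves the Schur complement, which is again positive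
  semidefinite.\<close>

lemma psd_kernel_decompose:
  assumes "finite S" "psd_kernel S A"
  obtains V where "\<And>r c. r \<in> S \<Longrightarrow> c \<in> S \<Longrightarrow> A r c = (\<Sum>k\<in>S. V k r * cnj (V k c))"
proof -
  have "\<exists>V. \<forall>r\<in>S. \<forall>c\<in>S. A r c = (\<Sum>k\<in>S. V k r * cnj (V k c))"
    using assms
  proof (induction S arbitrary: A rule: finite_induct)
    case empty
    then show ?case by simp
  next
    case (insert s S A)
    let ?S = "insert s S"
    note A = insert.prems
    have fin: "finite ?S" using insert.hyps by simp
    define a where "a = Re (A s s)"
    have Ass: "A s s = of_real a" and a0: "0 \<le> a"
      using psd_kernel_diag[OF A fin, of s] by (auto simp: a_def less_eq_complex_def complex_eq_iff)
    have herm: "A s r = cnj (A r s)" if "r \<in> ?S" for r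
      by (rule psd_kernel_hermitian[OF A fin]) (use that in auto)
    have null: "A r s = 0" if "r \<in> ?S" "a = 0" for r
      by (rule psd_kernel_null_row[OF A fin]) (use that Ass in auto)
    \<comment> \<open>If \<open>a = 0\<close>, the quotient is 0 by the convention for division;
      this is the right value, because the row and column of \<open>s\<close> then vanish.\<close>
    define B where "B r c = A r c - A r s * A s c / of_real a" for r c
    have "psd_kernel S B"
      unfolding psd_kernel_def
    proof
      fix x
      define u where "u = (\<Sum>c\<in>S. A s c * x c)"
      \<comment> \<open>This value at \<open>s\<close> minimises the form of \<open>A\<close> for
        fixed other coordinates, and the minimum is the form of \<open>B\<close> at
        \<open>x\<close>.\<close>
      define y where "y r = (if r = s then - u / of_real a else x r)" for r
      have u': "cnj u = (\<Sum>r\<in>S. cnj (x r) * A r s)"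
        unfolding u_def by (auto simp: herm mult_ac intro!: sum.cong)
      have uu: "cnj u * u = (\<Sum>r\<in>S. \<Sum>c\<in>S. (cnj (x r) * A r s) * (A s c * x c))"
        unfolding u' unfolding u_def sum_product ..
      have ua: "u = 0" if "a = 0"
        using that null herm by (auto simp: u_def intro!: sum.neutral)
      have y: "y r = x r" if "r \<in> S" for r
        using that insert.hyps by (auto simp: y_def)
      have "(\<Sum>r\<in>?S. \<Sum>c\<in>?S. cnj (y r) * A r c * y c)
        = cnj (y s) * A s s * y s + cnj (y s) * (\<Sum>c\<in>S. A s c * x c)
           + (\<Sum>r\<in>S. cnj (x r) * A r s) * y s + (\<Sum>r\<in>S. \<Sum>c\<in>S. cnj (x r) * A r c * x c)"
        using insert.hyps
        by (simp add: sum.distrib sum_distrib_left sum_distrib_right mult_ac y cong: sum.cong)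
      also have "\<dots> = (\<Sum>r\<in>S. \<Sum>c\<in>S. cnj (x r) * A r c * x c) - cnj u * u / of_real a"
        unfolding Ass u'[symmetric] u_def[symmetric] using ua by (simp add: y_def field_simps)
      also have "\<dots> = (\<Sum>r\<in>S. \<Sum>c\<in>S. cnj (x r) * B r c * x c)"
        unfolding uu B_def by (simp add: sum_divide_distrib sum_subtractf algebra_simps)
      finally show "0 \<le> (\<Sum>r\<in>S. \<Sum>c\<in>S. cnj (x r) * B r c * x c)"
        using psd_kernelD[OF A, of y] by simp
    qed
    from insert.IH[OF this] obtain V where
      V: "\<And>r c. r \<in> S \<Longrightarrow> c \<in> S \<Longrightarrow> B r c = (\<Sum>k\<in>S. V k r * cnj (V k c))" by blast
    \<comment> \<open>The new vector is the scaled column of \<open>s\<close>; the vectors from the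
      induction hypothesis are extended by zero at \<open>s\<close>.\<close>
    define W where "W k r = (if k = s then A r s / of_real (sqrt a) else if r = s then 0 else V k r)" for k r
    have sqrt: "of_real (sqrt a) * of_real (sqrt a) = (of_real a :: complex)"
      using a0 by (metis of_real_mult real_sqrt_mult_self abs_of_nonneg)
    have "A r c = (\<Sum>k\<in>?S. W k r * cnj (W k c))" if "r \<in> ?S" "c \<in> ?S" for r c
    proof -
      have "W s r * cnj (W s c) = A r s * A s c / of_real a"
        using herm[OF that(2)] sqrt by (simp add: W_def)
      moreover have "(\<Sum>k\<in>S. W k r * cnj (W k c)) = (if r = s \<or> c = s then 0 else B r c)"
      proof (cases "r = s \<or> c = s")
        case True
        then show ?thesis using insert.hyps by (auto simp: W_def intro!: sum.neutral)
      next
        case False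
        then show ?thesis using that insert.hyps by (auto simp: W_def V intro!: sum.cong)
      qed
      moreover have "A r c = A r s * A s c / of_real a" if "r = s \<or> c = s"
        using that null[OF \<open>r \<in> ?S\<close>] null[OF \<open>c \<in> ?S\<close>] herm[OF \<open>c \<in> ?S\<close>] Ass by auto
      ultimately show ?thesis using insert.hyps by (auto simp: B_def)
    qed
    then show ?case by blast
  qed
  then show ?thesis using that by blast
qed

text \<open>Writing \<open>A\<close> as a sum of rank-one kernels turns the form of the product at
  \<open>x\<close> into a sum of forms of \<open>B\<close> at the vectors
  \<open>cnj (V k r) * x r\<close>.\<close>

lemma psd_kernel_schur_product:
  assumes "finite S" "psd_kernel S A" "psd_kernel S B"
  shows "psd_kernel S (\<lambda>r c. A r c * B r c)"
  unfolding psd_kernel_def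
proof
  fix x :: "_ \<Rightarrow> complex"
  obtain V where V: "\<And>r c. r \<in> S \<Longrightarrow> c \<in> S \<Longrightarrow> A r c = (\<Sum>k\<in>S. V k r * cnj (V k c))"
    using psd_kernel_decompose[OF assms(1,2)] by blast
  let ?y = "\<lambda>k r. cnj (V k r) * x r"
  have "(\<Sum>r\<in>S. \<Sum>c\<in>S. cnj (x r) * (A r c * B r c) * x c)
      = (\<Sum>r\<in>S. \<Sum>c\<in>S. \<Sum>k\<in>S. cnj (?y k r) * B r c * ?y k c)"
    by (intro sum.cong refl) (simp add: V sum_distrib_left mult_ac)
  also have "\<dots> = (\<Sum>r\<in>S. \<Sum>k\<in>S. \<Sum>c\<in>S. cnj (?y k r) * B r c * ?y k c)"
    by (rule sum.cong[OF refl], rule sum.swap)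
  also have "\<dots> = (\<Sum>k\<in>S. \<Sum>r\<in>S. \<Sum>c\<in>S. cnj (?y k r) * B r c * ?y k c)"
    by (rule sum.swap)
  also have "0 \<le> \<dots>"
    by (intro sum_nonneg psd_kernelD[OF assms(3)])
  finally show "0 \<le> (\<Sum>r\<in>S. \<Sum>c\<in>S. cnj (x r) * (A r c * B r c) * x c)" .
qed

lemma psd_kernel_scale: "psd_kernel S A \<Longrightarrow> 0 \<le> a \<Longrightarrow> psd_kernel S (\<lambda>r c. of_real a * A r c)"
  unfolding psd_kernel_def
  by (simp add: mult.left_commute[of _ "of_real a"] mult.assoc less_eq_complex_def flip: sum_distrib_left)

section \<open>Positive semidefinite matrices as kernels\<close>

lemma self_adjoint_iff:
  assumes "A \<in> carrier_mat d d"
  shows "self_adjoint A \<longleftrightarrow> (\<forall>i<d. \<forall>j<d. A $$ (i, j) = cnj (A $$ (j, i)))"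
  using assms unfolding self_adjoint_def
  by (auto simp: mat_adjoint_def mat_eq_iff mat_of_rows_index eq_commute)

lemma positive_semidefinite_iff:
  "positive_semidefinite d A \<longleftrightarrow>
     A \<in> carrier_mat d d \<and> psd_kernel {..<d} (\<lambda>r c. A $$ (r, c))"
proof -
  have Q: "(A *\<^sub>v v) \<bullet>c v = (\<Sum>r\<in>{..<d}. \<Sum>c\<in>{..<d}. cnj (v $ r) * A $$ (r, c) * v $ c)"
    if "A \<in> carrier_mat d d" "v \<in> carrier_vec d" for v
    using that by (auto simp: scalar_prod_def sum_distrib_right sum_distrib_left atLeast0LessThan mult_ac intro!: sum.cong)
  show ?thesis
  proof (intro iffI conjI)
    assume P: "positive_semidefinite d A"
    then show c: "A \<in> carrier_mat d d" by (simp add: positive_semidefinite_def)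
    show "psd_kernel {..<d} (\<lambda>r c. A $$ (r, c))"
      unfolding psd_kernel_def
    proof
      fix x
      show "0 \<le> (\<Sum>r<d. \<Sum>ca<d. cnj (x r) * A $$ (r, ca) * x ca)"
        using P[unfolded positive_semidefinite_def, THEN conjunct2, THEN conjunct2, rule_format, OF vec_carrier[of d x]]
        unfolding Q[OF c vec_carrier] by simp
    qed
  next
    assume "A \<in> carrier_mat d d \<and> psd_kernel {..<d} (\<lambda>r c. A $$ (r, c))"
    then have c: "A \<in> carrier_mat d d" and P: "psd_kernel {..<d} (\<lambda>r c. A $$ (r, c))" by auto
    have "self_adjoint A"
      unfolding self_adjoint_iff[OF c] using psd_kernel_hermitian[OF P finite_lessThan] by blast
    then show "positive_semidefinite d A"
      using c psd_kernelD[OF P] by (simp add: positive_semidefinite_def Q[OF c])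
  qed
qed

section \<open>Tensor products of superoperators and Choi kernels\<close>

lemma product_index_less:
  fixes i k m n :: nat
  assumes "i < m" "k < n"
  shows "i * n + k < m * n"
proof -
  have "i * n + k < Suc i * n" using assms by simp
  also have "\<dots> \<le> m * n" using assms by (intro mult_le_mono1) simp
  finally show ?thesis .
qed

lemma product_index_div_mod:
  fixes r m n :: nat
  assumes "r < m * n"
  shows "r div n < m" "r mod n < n"
proof -
  have "0 < n" using assms by (cases n) auto
  then show "r div n < m" "r mod n < n" using assms by (auto simp: less_mult_imp_div_less)
qed

lemma sum_product_index:
  fixes f :: "nat \<Rightarrow> 'a::comm_monoid_add"
  shows "(\<Sum>p<m * n. f p) = (\<Sum>i<m. \<Sum>k<n. f (i * n + k))"
proof -
  have "(\<Sum>p<m * n. f p) = (\<Sum>i<m. sum f {i * n..<i * n + n})"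
    by (simp add: sum.nat_group)
  also have "\<dots> = (\<Sum>i<m. \<Sum>k<n. f (i * n + k))"
    by (rule sum.cong[OF refl]) (simp add: sum.atLeastLessThan_shift_0 atLeast0LessThan)
  finally show ?thesis .
qed

lemma sum_double_delta:
  assumes "finite A" "finite B" "a \<in> A" "b \<in> B"
  shows "(\<Sum>k\<in>A. \<Sum>l\<in>B. if k = a \<and> l = b then f k l else 0) = f a b"
proof -
  have "(\<Sum>l\<in>B. if k = a \<and> l = b then f k l else 0) = (if k = a then f k b else 0)" for k
    using assms by auto
  then show ?thesis using assms by simp
qed

lemma matrix_unit_carrier [simp]: "matrix_unit d i j \<in> carrier_mat d d"
  by (simp add: matrix_unit_def)

lemma matrix_unit_index [simp]:
  "r < d \<Longrightarrow> c < d \<Longrightarrow> matrix_unit d i j $$ (r, c) = (if r = i \<and> c = j then 1 else 0)"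
  by (simp add: matrix_unit_def)

lemma tensor_mat_index:
  assumes "A \<in> carrier_mat m m" "B \<in> carrier_mat n n" "r < m * n" "c < m * n"
  shows "tensor_mat A B $$ (r, c) = A $$ (r div n, c div n) * B $$ (r mod n, c mod n)"
  using assms by (simp add: tensor_mat_def)

lemma tensor_mat_carrier [simp]:
  "A \<in> carrier_mat m m \<Longrightarrow> B \<in> carrier_mat n n \<Longrightarrow> tensor_mat A B \<in> carrier_mat (m * n) (m * n)"
  by (simp add: tensor_mat_def)

lemma tensor_map_carrier [simp]: "tensor_map m n F G X \<in> carrier_mat (m * n) (m * n)"
  by (simp add: tensor_map_def)

lemma linear_superoperator_carrier:
  "linear_superoperator d F \<Longrightarrow> A \<in> carrier_mat d d \<Longrightarrow> F A \<in> carrier_mat d d"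
  by (simp add: linear_superoperator_def)

lemma linear_superoperator_id: "linear_superoperator d (\<lambda>Y. Y)"
  by (simp add: linear_superoperator_def)

lemma linear_superoperator_comp:
  "linear_superoperator d F \<Longrightarrow> linear_superoperator d G \<Longrightarrow> linear_superoperator d (F \<circ> G)"
  by (simp add: linear_superoperator_def)

lemma tensor_map_index:
  assumes "linear_superoperator m F" "linear_superoperator n G" "r < m * n" "c < m * n"
  shows "tensor_map m n F G X $$ (r, c) = (\<Sum>i<m. \<Sum>j<m. \<Sum>k<n. \<Sum>l<n. X $$ (i * n + k, j * n + l) *
    (F (matrix_unit m i j) $$ (r div n, c div n) * G (matrix_unit n k l) $$ (r mod n, c mod n)))"
  using assms
  by (simp add: tensor_map_def tensor_mat_index[OF linear_superoperator_carrier[OF assms(1)]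
        linear_superoperator_carrier[OF assms(2)]])

text \<open>The identity on the ancilla collapses the sums over \<open>k\<close> and
  \<open>l\<close>. What remains is a sum over input indices of a product of two factors, the shape
  to which \<open>psd_kernel_schur_product\<close> and \<open>psd_kernel_marginal\<close>
  apply.\<close>

lemma tensor_map_id_index:
  assumes "linear_superoperator d F" "r < d * n" "c < d * n"
  shows "tensor_map d n F (\<lambda>Y. Y) X $$ (r, c) =
    (\<Sum>i<d. \<Sum>j<d. F (matrix_unit d i j) $$ (r div n, c div n) * X $$ (i * n + r mod n, j * n + c mod n))"
proof -
  note lt = product_index_div_mod[OF assms(2)] product_index_div_mod[OF assms(3)]
  have "(\<Sum>k<n. \<Sum>l<n. X $$ (i * n + k, j * n + l) * (a * matrix_unit n k l $$ (r mod n, c mod n)))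
      = a * X $$ (i * n + r mod n, j * n + c mod n)" for i j a
  proof -
    have "(\<Sum>k<n. \<Sum>l<n. X $$ (i * n + k, j * n + l) * (a * matrix_unit n k l $$ (r mod n, c mod n)))
      = (\<Sum>k<n. \<Sum>l<n. if k = r mod n \<and> l = c mod n then a * X $$ (i * n + k, j * n + l) else 0)"
      using lt by (intro sum.cong refl) auto
    also have "\<dots> = a * X $$ (i * n + r mod n, j * n + c mod n)"
      using lt by (intro sum_double_delta) auto
    finally show ?thesis .
  qed
  then show ?thesis
    by (simp add: tensor_map_index[OF assms(1) linear_superoperator_id assms(2,3)])
qed

lemma linear_superoperator_tensor_map: "linear_superoperator (m * n) (tensor_map m n F G)"
  unfolding linear_superoperator_def
proof (intro conjI ballI allI)
  fix A B :: "complex mat"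
  assume "A \<in> carrier_mat (m * n) (m * n)" "B \<in> carrier_mat (m * n) (m * n)"
  then show "tensor_map m n F G (A + B) = tensor_map m n F G A + tensor_map m n F G B"
    by (intro eq_matI) (auto simp: tensor_map_def product_index_less distrib_right sum.distrib)
next
  fix a and A :: "complex mat"
  assume "A \<in> carrier_mat (m * n) (m * n)"
  then show "tensor_map m n F G (a \<cdot>\<^sub>m A) = a \<cdot>\<^sub>m tensor_map m n F G A"
    by (intro eq_matI) (auto simp: tensor_map_def product_index_less sum_distrib_left mult_ac)
qed simp

lemma matrix_unit_product:
  assumes "p < m * n" "q < m * n"
  shows "matrix_unit (m * n) p q =
    tensor_mat (matrix_unit m (p div n) (q div n)) (matrix_unit n (p mod n) (q mod n))"
proof (rule eq_matI, goal_cases)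
  case (1 r c)
  then have rc: "r < m * n" "c < m * n" by (auto simp: tensor_mat_def matrix_unit_def)
  have eq: "r div n = p div n \<and> r mod n = p mod n \<longleftrightarrow> r = p" for r p :: nat
    by (metis div_mult_mod_eq)
  show ?case
    using rc product_index_div_mod[OF rc(1)] product_index_div_mod[OF rc(2)] eq[of r p] eq[of c q]
    by (auto simp: tensor_mat_index[of _ m _ n])
qed (auto simp: tensor_mat_def matrix_unit_def)

lemma tensor_map_matrix_unit:
  assumes "linear_superoperator m F" "linear_superoperator n G" "p < m * n" "q < m * n"
  shows "tensor_map m n F G (matrix_unit (m * n) p q) =
    tensor_mat (F (matrix_unit m (p div n) (q div n))) (G (matrix_unit n (p mod n) (q mod n)))"
  by (simp add: matrix_unit_product assms tensor_map_tensor_mat)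

lemma mat_trace_carrier: "A \<in> carrier_mat d d \<Longrightarrow> mat_trace A = (\<Sum>i<d. A $$ (i, i))"
  by (simp add: mat_trace_def)

lemma mat_trace_matrix_unit: "p < d \<Longrightarrow> mat_trace (matrix_unit d p q) = (if p = q then 1 else 0)"
  by (auto simp: mat_trace_carrier[OF matrix_unit_carrier] sum.delta)

lemma mat_trace_tensor_mat:
  assumes "A \<in> carrier_mat m m" "B \<in> carrier_mat n n"
  shows "mat_trace (tensor_mat A B) = mat_trace A * mat_trace B"
  by (simp add: mat_trace_carrier[OF assms(1)] mat_trace_carrier[OF assms(2)] assms
      mat_trace_carrier[OF tensor_mat_carrier[OF assms]] tensor_mat_index[OF assms] product_index_less
      sum_product_index sum_product)

lemma trace_preserving_iff:
  assumes F: "linear_superoperator d F"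
  shows "trace_preserving d F \<longleftrightarrow>
    (\<forall>p<d. \<forall>q<d. mat_trace (F (matrix_unit d p q)) = (if p = q then 1 else 0))"
proof
  assume "trace_preserving d F"
  then show "\<forall>p<d. \<forall>q<d. mat_trace (F (matrix_unit d p q)) = (if p = q then 1 else 0)"
    by (auto simp: trace_preserving_def mat_trace_matrix_unit)
next
  assume T: "\<forall>p<d. \<forall>q<d. mat_trace (F (matrix_unit d p q)) = (if p = q then 1 else 0)"
  show "trace_preserving d F"
    unfolding trace_preserving_def
  proof
    fix A :: "complex mat" assume A: "A \<in> carrier_mat d d"
    have "mat_trace (F A) = (\<Sum>r<d. \<Sum>p<d. \<Sum>q<d. A $$ (p, q) * F (matrix_unit d p q) $$ (r, r))"
      using linear_superoperator_carrier[OF F A]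
      by (simp add: mat_trace_carrier linear_superoperator_matrix_units[OF F A])
    also have "\<dots> = (\<Sum>p<d. \<Sum>r<d. \<Sum>q<d. A $$ (p, q) * F (matrix_unit d p q) $$ (r, r))"
      by (rule sum.swap)
    also have "\<dots> = (\<Sum>p<d. \<Sum>q<d. \<Sum>r<d. A $$ (p, q) * F (matrix_unit d p q) $$ (r, r))"
      by (rule sum.cong[OF refl], rule sum.swap)
    also have "\<dots> = (\<Sum>p<d. \<Sum>q<d. A $$ (p, q) * mat_trace (F (matrix_unit d p q)))"
      by (simp add: mat_trace_carrier[OF linear_superoperator_carrier[OF F]] sum_distrib_left)
    also have "\<dots> = (\<Sum>p<d. \<Sum>q<d. if p = q then A $$ (p, q) else 0)"
      using T by (intro sum.cong refl) auto
    also have "\<dots> = mat_trace A" using A by (simp add: mat_trace_carrier sum.delta)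
    finally show "mat_trace (F A) = mat_trace A" .
  qed
qed

section \<open>Choi kernels and complete positivity\<close>

text \<open>The Choi matrix of \<open>F\<close>; each label is a pair of an output index and an
  input index.\<close>

definition choi_kernel :: "nat \<Rightarrow> (complex mat \<Rightarrow> complex mat) \<Rightarrow> nat \<times> nat \<Rightarrow> nat \<times> nat \<Rightarrow> complex" where
  "choi_kernel d F = (\<lambda>(r, i) (c, j). F (matrix_unit d i j) $$ (r, c))"

text \<open>Choi's theorem. One direction evaluates the extension of \<open>F\<close> at a multiple
  of a maximally entangled projection. In the other, the image of any \<open>X\<close> is a
  marginal, over the input index, of the Schur product of the Choi kernel with a pullback of
  \<open>X\<close>.\<close>

lemma completely_positive_iff:
  assumes F: "linear_superoperator d F"
  shows "completely_positive d F \<longleftrightarrow> psd_kernel ({..<d} \<times> {..<d}) (choi_kernel d F)"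
proof
  assume CP: "completely_positive d F"
  define X :: "complex mat" where "X = mat (d * d) (d * d)
    (\<lambda>(r, c). (if r div d = r mod d then 1 else 0) * cnj (if c div d = c mod d then 1 else 0))"
  have "positive_semidefinite (d * d) X"
    unfolding positive_semidefinite_iff
    by (auto simp: X_def intro: psd_kernel_cong[OF psd_kernel_rank_one[of _ "\<lambda>r. if r div d = r mod d then 1 else 0"]])
  with CP have P: "psd_kernel {..<d * d} (\<lambda>r c. tensor_map d d F (\<lambda>Y. Y) X $$ (r, c))"
    by (simp add: completely_positive_def positive_semidefinite_iff)
  have "psd_kernel ({..<d} \<times> {..<d}) (\<lambda>r c. tensor_map d d F (\<lambda>Y. Y) X $$ (fst r * d + snd r, fst c * d + snd c))"
    by (rule psd_kernel_pullback[OF P, of _ "\<lambda>r. fst r * d + snd r"]) (auto intro: product_index_less)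
  then show "psd_kernel ({..<d} \<times> {..<d}) (choi_kernel d F)"
  proof (rule psd_kernel_cong, clarify, goal_cases)
    case (1 r i c j)
    then have "tensor_map d d F (\<lambda>Y. Y) X $$ (r * d + i, c * d + j)
      = (\<Sum>k<d. \<Sum>l<d. F (matrix_unit d k l) $$ (r, c) * (if k = i \<and> l = j then 1 else 0))"
      by (auto simp: tensor_map_id_index[OF F] product_index_less X_def intro!: sum.cong)
    also have "\<dots> = (\<Sum>k<d. \<Sum>l<d. if k = i \<and> l = j then F (matrix_unit d k l) $$ (r, c) else 0)"
      by (intro sum.cong refl) auto
    also have "\<dots> = F (matrix_unit d i j) $$ (r, c)" using 1 by (intro sum_double_delta) auto
    finally show ?case by (simp add: choi_kernel_def)
  qed
next
  assume C: "psd_kernel ({..<d} \<times> {..<d}) (choi_kernel d F)"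
  show "completely_positive d F"
    unfolding completely_positive_def
  proof (intro allI impI)
    fix n X assume "positive_semidefinite (d * n) X"
    then have X: "psd_kernel {..<d * n} (\<lambda>r c. X $$ (r, c))" by (simp add: positive_semidefinite_iff)
    let ?S = "{..<d * n} \<times> {..<d}"
    have K1: "psd_kernel ?S (\<lambda>p q. choi_kernel d F (fst p div n, snd p) (fst q div n, snd q))"
      by (rule psd_kernel_pullback[OF C, of ?S "\<lambda>p. (fst p div n, snd p)"])
        (auto dest: product_index_div_mod)
    have K2: "psd_kernel ?S (\<lambda>p q. X $$ (snd p * n + fst p mod n, snd q * n + fst q mod n))"
      by (rule psd_kernel_pullback[OF X, of ?S "\<lambda>p. snd p * n + fst p mod n"])
        (auto intro!: product_index_less dest: product_index_div_mod)
    have "psd_kernel ?S (\<lambda>(r, i) (c, j). F (matrix_unit d i j) $$ (r div n, c div n)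
         * X $$ (i * n + r mod n, j * n + c mod n))"
      using psd_kernel_schur_product[OF _ K1 K2] by (simp add: choi_kernel_def case_prod_unfold)
    from psd_kernel_marginal[OF this]
    show "positive_semidefinite (d * n) (tensor_map d n F (\<lambda>Y. Y) X)"
      unfolding positive_semidefinite_iff
      by (auto simp: tensor_map_id_index[OF F] intro: psd_kernel_cong)
  qed
qed

text \<open>The Choi kernel of a composition is the Schur product of the two Choi kernels, summed
  over the intermediate indices.\<close>

lemma quantum_channel_comp:
  assumes F: "quantum_channel d F" and G: "quantum_channel d G"
  shows "quantum_channel d (F \<circ> G)"
proof -
  have lin: "linear_superoperator d F" "linear_superoperator d G"
    and cp: "psd_kernel ({..<d} \<times> {..<d}) (choi_kernel d F)" "psd_kernel ({..<d} \<times> {..<d}) (choi_kernel d G)"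
    using F G by (auto simp: quantum_channel_def completely_positive_iff)
  let ?S = "({..<d} \<times> {..<d}) \<times> {..<d}"
  have K1: "psd_kernel ?S (\<lambda>p q. choi_kernel d G (snd p, snd (fst p)) (snd q, snd (fst q)))"
    by (rule psd_kernel_pullback[OF cp(2), of ?S "\<lambda>p. (snd p, snd (fst p))"]) auto
  have K2: "psd_kernel ?S (\<lambda>p q. choi_kernel d F (fst (fst p), snd p) (fst (fst q), snd q))"
    by (rule psd_kernel_pullback[OF cp(1), of ?S "\<lambda>p. (fst (fst p), snd p)"]) auto
  have "psd_kernel ?S (\<lambda>(p, k) (q, l). G (matrix_unit d (snd p) (snd q)) $$ (k, l)
         * F (matrix_unit d k l) $$ (fst p, fst q))"
    using psd_kernel_schur_product[OF _ K1 K2] by (simp add: choi_kernel_def case_prod_unfold)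
  from psd_kernel_marginal[OF this]
  have "psd_kernel ({..<d} \<times> {..<d}) (choi_kernel d (F \<circ> G))"
    by (rule psd_kernel_cong)
      (auto simp: choi_kernel_def linear_superoperator_matrix_units[OF lin(1) linear_superoperator_carrier[OF lin(2)]])
  then show ?thesis
    using F G by (auto simp: quantum_channel_def completely_positive_iff linear_superoperator_comp
        trace_preserving_def linear_superoperator_carrier)
qed

text \<open>The Choi kernel of a tensor product is the Schur product of the two Choi kernels pulled
  back along quotient and remainder. Trace preservation is checked on matrix units, whose images
  factor.\<close>

lemma quantum_channel_tensor_map:
  assumes F: "quantum_channel m F" and G: "quantum_channel n G"
  shows "quantum_channel (m * n) (tensor_map m n F G)"
proof -
  have lin: "linear_superoperator m F" "linear_superoperator n G"
    and cp: "psd_kernel ({..<m} \<times> {..<m}) (choi_kernel m F)" "psd_kernel ({..<n} \<times> {..<n}) (choi_kernel n G)"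
    using F G by (auto simp: quantum_channel_def completely_positive_iff)
  note carr = linear_superoperator_carrier[OF lin(1) matrix_unit_carrier]
    linear_superoperator_carrier[OF lin(2) matrix_unit_carrier]
  let ?S = "{..<m * n} \<times> {..<m * n}"
  have K1: "psd_kernel ?S (\<lambda>p q. choi_kernel m F (fst p div n, snd p div n) (fst q div n, snd q div n))"
    by (rule psd_kernel_pullback[OF cp(1), of ?S "\<lambda>p. (fst p div n, snd p div n)"])
      (auto dest: product_index_div_mod)
  have K2: "psd_kernel ?S (\<lambda>p q. choi_kernel n G (fst p mod n, snd p mod n) (fst q mod n, snd q mod n))"
    by (rule psd_kernel_pullback[OF cp(2), of ?S "\<lambda>p. (fst p mod n, snd p mod n)"])
      (auto dest: product_index_div_mod)
  have "psd_kernel ?S (choi_kernel (m * n) (tensor_map m n F G))"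
    by (rule psd_kernel_cong[OF psd_kernel_schur_product[OF _ K1 K2]])
      (auto simp: choi_kernel_def tensor_map_matrix_unit[OF lin] tensor_mat_index[OF carr])
  moreover have "mat_trace (tensor_map m n F G (matrix_unit (m * n) p q)) = (if p = q then 1 else 0)"
    if pq: "p < m * n" "q < m * n" for p q
  proof -
    have "p div n = q div n \<and> p mod n = q mod n \<longleftrightarrow> p = q" by (metis div_mult_mod_eq)
    then show ?thesis
      using F G product_index_div_mod[OF pq(1)] product_index_div_mod[OF pq(2)]
      by (auto simp: tensor_map_matrix_unit[OF lin pq] mat_trace_tensor_mat[OF carr] quantum_channel_def
          trace_preserving_iff)
  qed
  ultimately show ?thesis
    by (simp add: quantum_channel_def completely_positive_iff linear_superoperator_tensor_map trace_preserving_iff)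
qed

section \<open>The cone of separable matrices\<close>

lemma positive_semidefinite_carrier: "positive_semidefinite d A \<Longrightarrow> A \<in> carrier_mat d d"
  by (simp add: positive_semidefinite_def)

lemma positive_semidefinite_smult:
  "positive_semidefinite d A \<Longrightarrow> 0 \<le> a \<Longrightarrow> positive_semidefinite d (of_real a \<cdot>\<^sub>m A)"
  unfolding positive_semidefinite_iff
  by (auto intro: psd_kernel_cong[OF psd_kernel_scale])

text \<open>The diagonal entries are nonnegative, so trace zero kills the diagonal and then, by
  \<open>psd_kernel_null_row\<close>, the whole matrix. This permits normalisation to
  states.\<close>

lemma positive_semidefinite_trace:
  assumes "positive_semidefinite d A"
  obtains a where "0 \<le> a" "mat_trace A = of_real a" "a = 0 \<Longrightarrow> A = 0\<^sub>m d d"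
proof -
  have A: "A \<in> carrier_mat d d" and P: "psd_kernel {..<d} (\<lambda>r c. A $$ (r, c))"
    using assms by (auto simp: positive_semidefinite_iff)
  have diag: "0 \<le> A $$ (i, i)" if "i < d" for i
    using psd_kernel_diag[OF P] that by simp
  have nonneg: "0 \<le> mat_trace A" using diag by (auto simp: mat_trace_carrier[OF A] intro: sum_nonneg)
  show ?thesis
  proof (rule that[of "Re (mat_trace A)"])
    assume "Re (mat_trace A) = 0"
    then have "(\<Sum>i<d. A $$ (i, i)) = 0"
      using nonneg by (simp add: mat_trace_carrier[OF A] complex_eq_iff less_eq_complex_def)
    then have "\<forall>i\<in>{..<d}. A $$ (i, i) = 0"
      using sum_nonneg_eq_0_iff[of "{..<d}" "\<lambda>i. A $$ (i, i)"] diag by auto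
    then show "A = 0\<^sub>m d d"
      using psd_kernel_null_row[OF P finite_lessThan] A by (intro eq_matI) auto
  qed (use nonneg in \<open>auto simp: less_eq_complex_def complex_eq_iff\<close>)
qed

text \<open>Unnormalised separable states. Without weights and normalisation, the pieces of a
  decomposition can be treated one at a time; states are recovered once, in
  \<open>separable_if_sep_cone\<close>.\<close>

inductive_set sep_cone :: "nat \<Rightarrow> nat \<Rightarrow> complex mat set" for m n where
  zero: "0\<^sub>m (m * n) (m * n) \<in> sep_cone m n"
| add: "X \<in> sep_cone m n \<Longrightarrow> positive_semidefinite m A \<Longrightarrow> positive_semidefinite n B \<Longrightarrow>
    X + tensor_mat A B \<in> sep_cone m n"

lemma sep_cone_carrier: "X \<in> sep_cone m n \<Longrightarrow> X \<in> carrier_mat (m * n) (m * n)"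
  by (induction rule: sep_cone.induct) (auto simp: positive_semidefinite_carrier intro: add_carrier_mat)

lemma sep_cone_tensor_mat:
  assumes "positive_semidefinite m A" "positive_semidefinite n B"
  shows "tensor_mat A B \<in> sep_cone m n"
  using sep_cone.add[OF sep_cone.zero assms] left_add_zero_mat[OF tensor_mat_carrier]
    assms[THEN positive_semidefinite_carrier] by simp

lemma sep_cone_add:
  assumes X: "X \<in> sep_cone m n" and "Y \<in> sep_cone m n"
  shows "X + Y \<in> sep_cone m n"
  using assms(2)
proof (induction rule: sep_cone.induct)
  case zero
  then show ?case using X right_add_zero_mat[OF sep_cone_carrier[OF X]] by simp
next
  case (add Y A B)
  have "X + (Y + tensor_mat A B) = X + Y + tensor_mat A B"
    using add by (intro assoc_add_mat[symmetric, OF sep_cone_carrier[OF X] sep_cone_carrier])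
      (auto simp: positive_semidefinite_carrier)
  then show ?case using sep_cone.add add by simp
qed

lemma sep_cone_smult:
  assumes "X \<in> sep_cone m n" "0 \<le> a"
  shows "of_real a \<cdot>\<^sub>m X \<in> sep_cone m n"
  using assms(1)
proof (induction rule: sep_cone.induct)
  case zero
  have "complex_of_real a \<cdot>\<^sub>m 0\<^sub>m (m * n) (m * n) = 0\<^sub>m (m * n) (m * n)" by (intro eq_matI) auto
  then show ?case using sep_cone.zero by metis
next
  case (add X A B)
  have c: "X \<in> carrier_mat (m * n) (m * n)" "A \<in> carrier_mat m m" "B \<in> carrier_mat n n"
    using add sep_cone_carrier positive_semidefinite_carrier by auto
  have "of_real a \<cdot>\<^sub>m (X + tensor_mat A B) = of_real a \<cdot>\<^sub>m X + tensor_mat (of_real a \<cdot>\<^sub>m A) B"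
    using c by (intro eq_matI) (auto simp: tensor_mat_def product_index_div_mod distrib_left)
  then show ?case using sep_cone.add[OF add.IH positive_semidefinite_smult] add assms by simp
qed

lemma sep_cone_sum:
  assumes "finite S" "\<And>k. k \<in> S \<Longrightarrow> M k \<in> sep_cone m n"
  shows "mat (m * n) (m * n) (\<lambda>ij. \<Sum>k\<in>S. M k $$ ij) \<in> sep_cone m n"
  using assms
proof (induction S rule: finite_induct)
  case empty
  have "mat (m * n) (m * n) (\<lambda>ij. 0 :: complex) = 0\<^sub>m (m * n) (m * n)" by (intro eq_matI) auto
  then show ?case using sep_cone.zero by simp
next
  case (insert s S)
  have "M s + mat (m * n) (m * n) (\<lambda>ij. \<Sum>k\<in>S. M k $$ ij) \<in> sep_cone m n"
    using insert by (intro sep_cone_add) auto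
  also have "M s + mat (m * n) (m * n) (\<lambda>ij. \<Sum>k\<in>S. M k $$ ij)
      = mat (m * n) (m * n) (\<lambda>ij. \<Sum>k\<in>insert s S. M k $$ ij)"
    using insert sep_cone_carrier[of "M s"] by (intro eq_matI) auto
  finally show ?case .
qed

text \<open>Each summand is rescaled to a product of states whose weight is the product of the two
  traces; a summand with a factor of trace zero vanishes and is dropped. The weights then add up to
  the trace of \<open>X\<close>.\<close>

lemma separable_if_sep_cone:
  assumes X: "X \<in> sep_cone m n" and tr: "mat_trace X = 1"
  shows "separable m n X"
proof -
  have "\<exists>(K::nat) p \<alpha> \<beta>.
        (\<forall>k<K. (0::real) \<le> p k \<and> quantum_state m (\<alpha> k) \<and> quantum_state n (\<beta> k)) \<and>
        X = mat (m * n) (m * n)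
               (\<lambda>(r, c). \<Sum>k<K. complex_of_real (p k) * tensor_mat (\<alpha> k) (\<beta> k) $$ (r, c))"
    using X
  proof (induction rule: sep_cone.induct)
    case zero
    have "0\<^sub>m (m * n) (m * n) = mat (m * n) (m * n) (\<lambda>(r, c). 0 :: complex)" by (intro eq_matI) auto
    then show ?case by (intro exI[of _ 0]) auto
  next
    case (add X A B)
    from add.IH obtain K :: nat and p \<alpha> \<beta> where st: "\<forall>k<K. (0::real) \<le> p k \<and> quantum_state m (\<alpha> k) \<and> quantum_state n (\<beta> k)"
      and X: "X = mat (m * n) (m * n)
               (\<lambda>(r, c). \<Sum>k<K. complex_of_real (p k) * tensor_mat (\<alpha> k) (\<beta> k) $$ (r, c))"
      by blast
    have c: "A \<in> carrier_mat m m" "B \<in> carrier_mat n n"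
      using add positive_semidefinite_carrier by auto
    obtain a where a: "0 \<le> a" "mat_trace A = of_real a" "a = 0 \<Longrightarrow> A = 0\<^sub>m m m"
      using positive_semidefinite_trace[OF add(2)] by metis
    obtain b where b: "0 \<le> b" "mat_trace B = of_real b" "b = 0 \<Longrightarrow> B = 0\<^sub>m n n"
      using positive_semidefinite_trace[OF add(3)] by metis
    show ?case
    proof (cases "a = 0 \<or> b = 0")
      case True
      then have "X + tensor_mat A B = X"
        using a(3) b(3) c unfolding X
        by (intro eq_matI) (auto simp: tensor_mat_def product_index_div_mod)
      then show ?thesis using add.IH by (simp only:)
    next
      case False
      let ?A = "of_real (1 / a) \<cdot>\<^sub>m A" and ?B = "of_real (1 / b) \<cdot>\<^sub>m B"
      have "mat_trace ?A = of_real (1 / a) * mat_trace A" "mat_trace ?B = of_real (1 / b) * mat_trace B"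
        using c by (simp_all add: mat_trace_def sum_divide_distrib)
      then have "mat_trace ?A = 1" "mat_trace ?B = 1" using False a(2) b(2) by simp_all
      then have qs: "quantum_state m ?A" "quantum_state n ?B"
        unfolding quantum_state_def using a(1) b(1) add(2,3)
        by (auto intro: positive_semidefinite_smult simp del: of_real_divide)
      have eq: "X + tensor_mat A B = mat (m * n) (m * n) (\<lambda>(r, c). \<Sum>k<Suc K.
          complex_of_real ((p(K := a * b)) k) * tensor_mat ((\<alpha>(K := ?A)) k) ((\<beta>(K := ?B)) k) $$ (r, c))"
        using c False unfolding X
        by (intro eq_matI) (simp_all add: tensor_mat_def product_index_div_mod)
      show ?thesis
        by (rule exI[of _ "Suc K"], rule exI[of _ "p(K := a * b)"], rule exI[of _ "\<alpha>(K := ?A)"],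
            rule exI[of _ "\<beta>(K := ?B)"], rule conjI[OF _ eq])
          (use st qs a b in \<open>auto simp: less_Suc_eq\<close>)
    qed
  qed
  then obtain K :: nat and p \<alpha> \<beta> where st: "\<forall>k<K. (0::real) \<le> p k \<and> quantum_state m (\<alpha> k) \<and> quantum_state n (\<beta> k)"
      and eq: "X = mat (m * n) (m * n)
               (\<lambda>(r, c). \<Sum>k<K. complex_of_real (p k) * tensor_mat (\<alpha> k) (\<beta> k) $$ (r, c))"
    by blast
  have "mat_trace X = (\<Sum>r<m * n. \<Sum>k<K. complex_of_real (p k) * tensor_mat (\<alpha> k) (\<beta> k) $$ (r, r))"
    unfolding eq by (simp add: mat_trace_def)
  also have "\<dots> = (\<Sum>k<K. complex_of_real (p k) * (\<Sum>r<m * n. tensor_mat (\<alpha> k) (\<beta> k) $$ (r, r)))"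
    by (subst sum.swap) (simp add: sum_distrib_left)
  also have "\<dots> = (\<Sum>k<K. complex_of_real (p k))"
  proof (rule sum.cong[OF refl])
    fix k assume "k \<in> {..<K}"
    then have s: "quantum_state m (\<alpha> k)" "quantum_state n (\<beta> k)" using st by auto
    then have c: "\<alpha> k \<in> carrier_mat m m" "\<beta> k \<in> carrier_mat n n"
      by (auto simp: quantum_state_def positive_semidefinite_carrier)
    show "complex_of_real (p k) * (\<Sum>r<m * n. tensor_mat (\<alpha> k) (\<beta> k) $$ (r, r)) = complex_of_real (p k)"
      using s mat_trace_tensor_mat[OF c] mat_trace_carrier[OF tensor_mat_carrier[OF c]]
      by (simp add: quantum_state_def)
  qed
  finally have "complex_of_real (\<Sum>k<K. p k) = 1" using tr by simp
  then have "(\<Sum>k<K. p k) = 1" using of_real_eq_1_iff by blast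
  then show ?thesis
    unfolding separable_def
    by (intro exI[of _ K] exI[of _ p] exI[of _ \<alpha>] exI[of _ \<beta>] conjI st eq)
qed

lemma quantum_channel_id: "quantum_channel d (\<lambda>Y. Y)"
proof -
  have "psd_kernel ({..<d} \<times> {..<d}) (choi_kernel d (\<lambda>Y. Y))"
    by (rule psd_kernel_cong[OF psd_kernel_rank_one[of _ "\<lambda>p. if fst p = snd p then 1 else 0"]])
      (auto simp: choi_kernel_def)
  then show ?thesis
    by (simp add: quantum_channel_def linear_superoperator_id completely_positive_iff trace_preserving_def)
qed

section \<open>Pauli bases\<close>

lemma lessThan_2: "{..<2} = {0, 1::nat}" and lessThan_4: "{..<4} = {0, 1, 2, 3::nat}"
  and atLeastAtMost_1_3: "{1..3} = {1, 2, 3::nat}"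
  by auto

lemma mat_trace_mult:
  assumes "X \<in> carrier_mat d d" "Y \<in> carrier_mat d d"
  shows "mat_trace (X * Y) = (\<Sum>r<d. \<Sum>c<d. X $$ (r, c) * Y $$ (c, r))"
  using assms by (simp add: mat_trace_def scalar_prod_def atLeast0LessThan)

lemma mat_trace_mult_commute:
  assumes "X \<in> carrier_mat d d" "Y \<in> carrier_mat d d"
  shows "mat_trace (X * Y) = mat_trace (Y * X)"
  unfolding mat_trace_mult[OF assms] mat_trace_mult[OF assms(2,1)]
  by (subst sum.swap) (simp add: mult.commute)

lemma mat_trace_mult_Reals:
  assumes "X \<in> carrier_mat d d" "Y \<in> carrier_mat d d" "self_adjoint X" "self_adjoint Y"
  shows "mat_trace (X * Y) \<in> \<real>"
proof -
  have "cnj (mat_trace (X * Y)) = (\<Sum>r<d. \<Sum>c<d. X $$ (c, r) * Y $$ (r, c))"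
    unfolding mat_trace_mult[OF assms(1,2)] cnj_sum complex_cnj_mult
    using assms self_adjoint_iff[of _ d] by (intro sum.cong refl) (metis lessThan_iff)
  also have "\<dots> = mat_trace (X * Y)"
    unfolding mat_trace_mult[OF assms(1,2)] by (rule sum.swap)
  finally show ?thesis by (simp add: Reals_cnj_iff)
qed

text \<open>A locale, because the bases of both channels and both Schmidt frames are in use at the
  same time.\<close>

locale pauli_basis =
  fixes \<sigma> :: "nat \<Rightarrow> complex mat"
  assumes basis: "pauli_type_basis \<sigma>"
begin

lemma zero: "\<sigma> 0 = 1\<^sub>m 2"
  and carrier: "j < 4 \<Longrightarrow> \<sigma> j \<in> carrier_mat 2 2"
  and hermitian: "j < 4 \<Longrightarrow> self_adjoint (\<sigma> j)"
  and orthogonal: "j < 4 \<Longrightarrow> k < 4 \<Longrightarrow> mat_trace (\<sigma> j * \<sigma> k) = (if j = k then 2 else 0)"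
  using basis by (auto simp: pauli_type_basis_def)

lemma traceless: "j \<in> {1..3} \<Longrightarrow> mat_trace (\<sigma> j) = 0"
  using orthogonal[of j 0] carrier[of j] by (simp add: zero)

text \<open>Orthogonality read the other way round: after flattening to 4 by 4 matrices it says that
  \<open>A * B\<close> is the identity, and a one-sided inverse of a square matrix is
  two-sided.\<close>

lemma completeness:
  assumes "r < 2" "c < 2" "r' < 2" "c' < 2"
  shows "(\<Sum>j<4. \<sigma> j $$ (r, c) * \<sigma> j $$ (c', r')) = (if r = r' \<and> c = c' then 2 else 0)"
proof -
  define A where "A = mat 4 4 (\<lambda>(j, p). \<sigma> j $$ (p div 2, p mod 2))"
  define B where "B = mat 4 4 (\<lambda>(p, k). \<sigma> k $$ (p mod 2, p div 2) / 2)"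
  have carr: "A \<in> carrier_mat 4 4" "B \<in> carrier_mat 4 4" by (simp_all add: A_def B_def)
  have "A * B = 1\<^sub>m 4"
  proof (rule eq_matI, goal_cases)
    case (1 j k)
    then have jk: "j < 4" "k < 4" by auto
    have "(A * B) $$ (j, k) = (\<Sum>p<2 * 2. \<sigma> j $$ (p div 2, p mod 2) * \<sigma> k $$ (p mod 2, p div 2) / 2)"
      using jk by (simp add: A_def B_def scalar_prod_def atLeast0LessThan)
    also have "\<dots> = mat_trace (\<sigma> j * \<sigma> k) / 2"
      unfolding sum_product_index by (simp add: mat_trace_mult[OF carrier carrier] jk sum_divide_distrib)
    finally have "(A * B) $$ (j, k) = (if j = k then 2 else 0) / 2"
      unfolding orthogonal[OF jk] .
    then show ?case using jk by auto
  qed (simp_all add: A_def B_def)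
  then have "B * A = 1\<^sub>m 4" by (rule mat_mult_left_right_inverse[OF carr])
  moreover have lt: "c * 2 + r < 4" "c' * 2 + r' < 4" using assms by auto
  ultimately have "(B * A) $$ (c * 2 + r, c' * 2 + r') = (if c * 2 + r = c' * 2 + r' then 1 else 0)" by simp
  moreover have "(c * 2 + r = c' * 2 + r') = (r = r' \<and> c = c')" using assms by presburger
  moreover have "(B * A) $$ (c * 2 + r, c' * 2 + r') = (\<Sum>j<4. \<sigma> j $$ (r, c) * \<sigma> j $$ (c', r')) / 2"
    using lt assms by (simp add: A_def B_def scalar_prod_def atLeast0LessThan sum_divide_distrib)
  ultimately show ?thesis by (auto simp: field_simps)
qed

lemma expand:
  assumes X: "X \<in> carrier_mat 2 2" and "r < 2" "c < 2"
  shows "X $$ (r, c) = (\<Sum>j<4. mat_trace (X * \<sigma> j) / 2 * \<sigma> j $$ (r, c))"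
proof -
  have "(\<Sum>j<4. mat_trace (X * \<sigma> j) / 2 * \<sigma> j $$ (r, c))
     = (\<Sum>j<4. \<Sum>a<2. \<Sum>b<2. X $$ (a, b) / 2 * (\<sigma> j $$ (r, c) * \<sigma> j $$ (b, a)))"
    by (intro sum.cong refl)
      (simp add: mat_trace_mult[OF X carrier] sum_distrib_right sum_distrib_left sum_divide_distrib mult_ac)
  also have "\<dots> = (\<Sum>a<2. \<Sum>b<2. \<Sum>j<4. X $$ (a, b) / 2 * (\<sigma> j $$ (r, c) * \<sigma> j $$ (b, a)))"
    by (subst sum.swap, rule sum.cong[OF refl], rule sum.swap)
  also have "\<dots> = (\<Sum>a<2. \<Sum>b<2. if a = r \<and> b = c then X $$ (a, b) else 0)"
    unfolding sum_distrib_left[symmetric]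
    by (intro sum.cong refl) (use assms in \<open>auto simp: completeness\<close>)
  also have "\<dots> = X $$ (r, c)"
    by (rule sum_double_delta) (use assms in auto)
  finally show ?thesis ..
qed

lemma parseval:
  assumes X: "X \<in> carrier_mat 2 2" and Y: "Y \<in> carrier_mat 2 2"
  shows "mat_trace (X * Y) = (\<Sum>j<4. mat_trace (X * \<sigma> j) * mat_trace (Y * \<sigma> j)) / 2"
proof -
  have "mat_trace (X * Y) = (\<Sum>r<2. \<Sum>c<2. \<Sum>j<4. mat_trace (X * \<sigma> j) / 2 * (\<sigma> j $$ (r, c) * Y $$ (c, r)))"
    by (simp add: mat_trace_mult[OF X Y] expand[OF X] sum_distrib_right mult.assoc del: sum.lessThan_Suc)
  also have "\<dots> = (\<Sum>j<4. \<Sum>r<2. \<Sum>c<2. mat_trace (X * \<sigma> j) / 2 * (\<sigma> j $$ (r, c) * Y $$ (c, r)))"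
    by (subst sum.swap[of _ "{..<2}" "{..<4}"]) (rule sum.cong[OF refl], rule sum.swap)
  also have "\<dots> = (\<Sum>j<4. mat_trace (X * \<sigma> j) / 2 * mat_trace (\<sigma> j * Y))"
    by (intro sum.cong refl) (simp add: mat_trace_mult[OF carrier Y] sum_distrib_left)
  also have "\<dots> = (\<Sum>j<4. mat_trace (X * \<sigma> j) / 2 * mat_trace (Y * \<sigma> j))"
    by (intro sum.cong refl) (simp add: mat_trace_mult_commute[OF carrier Y])
  finally show ?thesis by (simp add: sum_divide_distrib)
qed

end

section \<open>Bloch vectors\<close>

lemma sum_lessThan_4_split:
  fixes f :: "nat \<Rightarrow> 'a::comm_monoid_add"
  shows "(\<Sum>j<4. f j) = f 0 + (\<Sum>j\<in>{1..3}. f j)"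
proof -
  have "{..<4} = insert 0 {1..3::nat}" by auto
  then show ?thesis by simp
qed

lemma tensor_mat_dim [simp]:
  "dim_row (tensor_mat A B) = dim_row A * dim_row B" "dim_col (tensor_mat A B) = dim_col A * dim_col B"
  by (simp_all add: tensor_mat_def)

definition traceless_hermitian :: "complex mat \<Rightarrow> bool" where
  "traceless_hermitian X \<longleftrightarrow> X \<in> carrier_mat 2 2 \<and> self_adjoint X \<and> mat_trace X = 0"

lemma (in pauli_basis) traceless_hermitian: "j \<in> {1..3} \<Longrightarrow> traceless_hermitian (\<sigma> j)"
  using carrier[of j] hermitian[of j] traceless[of j] by (simp add: traceless_hermitian_def)

text \<open>For a traceless Hermitian \<open>X\<close> this is the length of its Bloch vector, and
  the eigenvalues of \<open>X\<close> are plus and minus this number.\<close>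

definition bloch_norm :: "complex mat \<Rightarrow> real" where
  "bloch_norm X = sqrt (Re (mat_trace (X * X)) / 2)"

lemma traceless_hermitian_entries:
  assumes "traceless_hermitian X"
  obtains x z where "X $$ (0, 0) = of_real x" "X $$ (1, 1) = - of_real x" "X $$ (0, 1) = z" "X $$ (1, 0) = cnj z"
    "(bloch_norm X)\<^sup>2 = x\<^sup>2 + (cmod z)\<^sup>2" "mat_trace (X * X) = of_real (2 * (bloch_norm X)\<^sup>2)"
proof -
  have c: "X \<in> carrier_mat 2 2" using assms by (simp add: traceless_hermitian_def)
  have h: "X $$ (i, j) = cnj (X $$ (j, i))" if "i < 2" "j < 2" for i j
    using assms that unfolding traceless_hermitian_def self_adjoint_iff[OF c] by blast
  have x: "X $$ (0, 0) = of_real (Re (X $$ (0, 0)))"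
    using h[of 0 0] by (simp add: complex_eq_iff)
  have y: "X $$ (1, 1) = - of_real (Re (X $$ (0, 0)))"
    using assms x by (simp add: traceless_hermitian_def mat_trace_carrier[OF c] lessThan_2 add_eq_0_iff)
  have z: "X $$ (1, 0) = cnj (X $$ (0, 1))" using h[of 1 0] by simp
  have t: "mat_trace (X * X) = of_real (2 * ((Re (X $$ (0, 0)))\<^sup>2 + (cmod (X $$ (0, 1)))\<^sup>2))"
    unfolding mat_trace_mult[OF c c] lessThan_2 using x y z
    by (simp add: power2_eq_square complex_norm_square[symmetric] algebra_simps)
  then have b: "(bloch_norm X)\<^sup>2 = (Re (X $$ (0, 0)))\<^sup>2 + (cmod (X $$ (0, 1)))\<^sup>2"
    by (simp add: bloch_norm_def del: of_real_mult of_real_add of_real_power)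
  show ?thesis by (rule that[OF x y refl z b]) (simp add: t b)
qed

lemma bloch_norm_nonneg:
  assumes "traceless_hermitian X"
  shows "0 \<le> bloch_norm X"
proof -
  have "0 \<le> Re (mat_trace (X * X))"
    by (rule traceless_hermitian_entries[OF assms]) (simp del: of_real_mult of_real_power)
  then show ?thesis by (simp add: bloch_norm_def)
qed

section \<open>Positivity of Hermitian 2 by 2 matrices\<close>

text \<open>The determinant condition bounds the off-diagonal part of the form by twice the
  geometric mean of the two diagonal terms, hence by their sum.\<close>

lemma positive_semidefinite_2x2:
  assumes A: "A \<in> carrier_mat 2 2" "A $$ (0, 0) = of_real p" "A $$ (1, 1) = of_real q"
      "A $$ (0, 1) = z" "A $$ (1, 0) = cnj z"
    and p: "0 \<le> p" and q: "0 \<le> q" and z: "(cmod z)\<^sup>2 \<le> p * q"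
  shows "positive_semidefinite 2 A"
  unfolding positive_semidefinite_iff psd_kernel_def
proof (intro conjI allI A(1))
  fix x :: "nat \<Rightarrow> complex"
  let ?R = "p * (cmod (x 0))\<^sup>2 + q * (cmod (x 1))\<^sup>2 + 2 * Re (cnj (x 0) * z * x 1)"
  have "(\<Sum>r<2. \<Sum>c<2. cnj (x r) * A $$ (r, c) * x c)
      = of_real p * (x 0 * cnj (x 0)) + of_real q * (x 1 * cnj (x 1))
        + (cnj (x 0) * z * x 1 + cnj (cnj (x 0) * z * x 1))"
    using A(2-5) by (simp add: lessThan_2 algebra_simps)
  also have "\<dots> = of_real ?R"
    unfolding complex_add_cnj complex_norm_square[symmetric] by simp
  finally have Q: "(\<Sum>r<2. \<Sum>c<2. cnj (x r) * A $$ (r, c) * x c) = of_real ?R" .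
  have "cmod z \<le> sqrt (p * q)" using z by (simp add: real_le_rsqrt)
  then have "cmod (x 0) * cmod z * cmod (x 1) \<le> cmod (x 0) * sqrt (p * q) * cmod (x 1)"
    by (intro mult_right_mono mult_left_mono) auto
  moreover have "\<bar>Re (cnj (x 0) * z * x 1)\<bar> \<le> cmod (x 0) * cmod z * cmod (x 1)"
    using abs_Re_le_cmod[of "cnj (x 0) * z * x 1"] by (simp add: norm_mult)
  moreover have "0 \<le> (sqrt p * cmod (x 0) - sqrt q * cmod (x 1))\<^sup>2" by simp
  then have "2 * (cmod (x 0) * sqrt (p * q) * cmod (x 1)) \<le> p * (cmod (x 0))\<^sup>2 + q * (cmod (x 1))\<^sup>2"
    using p q by (simp add: power2_diff power_mult_distrib real_sqrt_mult algebra_simps)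
  ultimately have "0 \<le> ?R" by linarith
  then show "0 \<le> (\<Sum>r<2. \<Sum>c<2. cnj (x r) * A $$ (r, c) * x c)"
    unfolding Q by (simp add: less_eq_complex_def)
qed

text \<open>The eigenvalues are \<open>t\<close> plus and minus the Bloch length. In terms of
  entries, \<open>(t + x) * (t - x)\<close> dominates the squared modulus of \<open>z\<close>, which
  is the determinant condition.\<close>

lemma positive_semidefinite_add_traceless:
  assumes X: "traceless_hermitian X" and t: "bloch_norm X \<le> t"
  shows "positive_semidefinite 2 (of_real t \<cdot>\<^sub>m 1\<^sub>m 2 + X)"
    "positive_semidefinite 2 (of_real t \<cdot>\<^sub>m 1\<^sub>m 2 - X)"
proof -
  have c: "X \<in> carrier_mat 2 2" using X by (simp add: traceless_hermitian_def)
  obtain x z where e: "X $$ (0, 0) = of_real x" "X $$ (1, 1) = - of_real x" "X $$ (0, 1) = z" "X $$ (1, 0) = cnj z"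
    and b: "(bloch_norm X)\<^sup>2 = x\<^sup>2 + (cmod z)\<^sup>2"
    using traceless_hermitian_entries[OF X] by metis
  have t0: "0 \<le> t" using bloch_norm_nonneg[OF X] t by linarith
  have t2: "x\<^sup>2 + (cmod z)\<^sup>2 \<le> t\<^sup>2"
    using power_mono[OF t bloch_norm_nonneg[OF X], of 2] b by simp
  then have "\<bar>x\<bar> \<le> \<bar>t\<bar>" by (intro power2_le_iff_abs_le[THEN iffD1, OF _ ]) (auto simp: abs_le_square_iff intro: order_trans[rotated])
  then have x: "0 \<le> t + x" "0 \<le> t - x" using t0 by auto
  have z: "(cmod z)\<^sup>2 \<le> (t + x) * (t - x)" "(cmod z)\<^sup>2 \<le> (t - x) * (t + x)"
    using t2 by (simp_all add: power2_eq_square algebra_simps)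
  show "positive_semidefinite 2 (of_real t \<cdot>\<^sub>m 1\<^sub>m 2 + X)"
    by (rule positive_semidefinite_2x2[of _ "t + x" "t - x" z]) (use c e x z in \<open>simp_all add: minus_carrier_mat\<close>)
  show "positive_semidefinite 2 (of_real t \<cdot>\<^sub>m 1\<^sub>m 2 - X)"
    by (rule positive_semidefinite_2x2[of _ "t - x" "t + x" "- z"]) (use c e x z in \<open>simp_all add: minus_carrier_mat\<close>)
qed

text \<open>\<open>P\<close> and \<open>P'\<close> act as the two spectral projections of
  \<open>X\<close>: half the identity plus and minus half of the normalised \<open>X\<close>, so no
  eigenvectors have to be constructed.\<close>

lemma traceless_hermitian_split:
  assumes X: "traceless_hermitian X"
  obtains P P' where "positive_semidefinite 2 P" "positive_semidefinite 2 P'"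
    "\<And>r c. r < 2 \<Longrightarrow> c < 2 \<Longrightarrow> 1\<^sub>m 2 $$ (r, c) = P $$ (r, c) + P' $$ (r, c)"
    "\<And>r c. r < 2 \<Longrightarrow> c < 2 \<Longrightarrow> X $$ (r, c) = of_real (bloch_norm X) * (P $$ (r, c) - P' $$ (r, c))"
proof -
  have c: "X \<in> carrier_mat 2 2" using X by (simp add: traceless_hermitian_def)
  let ?n = "bloch_norm X"
  \<comment> \<open>If the Bloch length is 0 then \<open>X\<close> vanishes, any positive scale
    serves, and both matrices are half the identity.\<close>
  define s where "s = (if ?n = 0 then 1 else ?n)"
  have s: "0 < s" "?n \<le> s" using bloch_norm_nonneg[OF X] by (auto simp: s_def)
  have zero: "X $$ (r, c) = 0" if "?n = 0" "r < 2" "c < 2" for r c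
    by (rule traceless_hermitian_entries[OF X])
      (use that in \<open>auto simp: less_2_cases_iff sum_power2_eq_zero_iff\<close>)
  show ?thesis
  proof (rule that)
    show "positive_semidefinite 2 (of_real (1 / (2 * s)) \<cdot>\<^sub>m (of_real s \<cdot>\<^sub>m 1\<^sub>m 2 + X))"
      "positive_semidefinite 2 (of_real (1 / (2 * s)) \<cdot>\<^sub>m (of_real s \<cdot>\<^sub>m 1\<^sub>m 2 - X))"
      using s by (intro positive_semidefinite_smult positive_semidefinite_add_traceless[OF X]; simp)+
  qed (use c s zero in \<open>auto simp: s_def field_simps\<close>)
qed

text \<open>The four assumptions are the eigenvalues on product eigenvectors of \<open>X\<close> and
  \<open>Y\<close>, so the operator is a nonnegative combination of products of the matrices from
  \<open>traceless_hermitian_split\<close>.\<close>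

lemma sep_cone_diagonal:
  assumes X: "traceless_hermitian X" and Y: "traceless_hermitian Y"
    and nonneg: "0 \<le> \<alpha> + \<beta> * bloch_norm X + \<gamma> * bloch_norm Y + \<delta> * (bloch_norm X * bloch_norm Y)"
      "0 \<le> \<alpha> + \<beta> * bloch_norm X - \<gamma> * bloch_norm Y - \<delta> * (bloch_norm X * bloch_norm Y)"
      "0 \<le> \<alpha> - \<beta> * bloch_norm X + \<gamma> * bloch_norm Y - \<delta> * (bloch_norm X * bloch_norm Y)"
      "0 \<le> \<alpha> - \<beta> * bloch_norm X - \<gamma> * bloch_norm Y + \<delta> * (bloch_norm X * bloch_norm Y)"
  shows "of_real \<alpha> \<cdot>\<^sub>m tensor_mat (1\<^sub>m 2) (1\<^sub>m 2) + of_real \<beta> \<cdot>\<^sub>m tensor_mat X (1\<^sub>m 2)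
    + of_real \<gamma> \<cdot>\<^sub>m tensor_mat (1\<^sub>m 2) Y + of_real \<delta> \<cdot>\<^sub>m tensor_mat X Y \<in> sep_cone 2 2"
proof -
  let ?x = "bloch_norm X" and ?y = "bloch_norm Y"
  obtain P P' where P: "positive_semidefinite 2 P" "positive_semidefinite 2 P'"
    "\<And>r c. r < 2 \<Longrightarrow> c < 2 \<Longrightarrow> 1\<^sub>m 2 $$ (r, c) = P $$ (r, c) + P' $$ (r, c)"
    "\<And>r c. r < 2 \<Longrightarrow> c < 2 \<Longrightarrow> X $$ (r, c) = of_real ?x * (P $$ (r, c) - P' $$ (r, c))"
    using traceless_hermitian_split[OF X] by metis
  obtain Q Q' where Q: "positive_semidefinite 2 Q" "positive_semidefinite 2 Q'"
    "\<And>r c. r < 2 \<Longrightarrow> c < 2 \<Longrightarrow> 1\<^sub>m 2 $$ (r, c) = Q $$ (r, c) + Q' $$ (r, c)"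
    "\<And>r c. r < 2 \<Longrightarrow> c < 2 \<Longrightarrow> Y $$ (r, c) = of_real ?y * (Q $$ (r, c) - Q' $$ (r, c))"
    using traceless_hermitian_split[OF Y] by metis
  note carr = P(1,2)[THEN positive_semidefinite_carrier] Q(1,2)[THEN positive_semidefinite_carrier]
  have c: "X \<in> carrier_mat 2 2" "Y \<in> carrier_mat 2 2" using X Y by (simp_all add: traceless_hermitian_def)
  have "of_real \<alpha> \<cdot>\<^sub>m tensor_mat (1\<^sub>m 2) (1\<^sub>m 2) + of_real \<beta> \<cdot>\<^sub>m tensor_mat X (1\<^sub>m 2)
    + of_real \<gamma> \<cdot>\<^sub>m tensor_mat (1\<^sub>m 2) Y + of_real \<delta> \<cdot>\<^sub>m tensor_mat X Y =
    of_real (\<alpha> + \<beta> * ?x + \<gamma> * ?y + \<delta> * (?x * ?y)) \<cdot>\<^sub>m tensor_mat P Q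
    + of_real (\<alpha> + \<beta> * ?x - \<gamma> * ?y - \<delta> * (?x * ?y)) \<cdot>\<^sub>m tensor_mat P Q'
    + of_real (\<alpha> - \<beta> * ?x + \<gamma> * ?y - \<delta> * (?x * ?y)) \<cdot>\<^sub>m tensor_mat P' Q
    + of_real (\<alpha> - \<beta> * ?x - \<gamma> * ?y + \<delta> * (?x * ?y)) \<cdot>\<^sub>m tensor_mat P' Q'"
    (is "?L = ?R")
  proof (rule eq_matI, goal_cases)
    case (1 i j)
    then have ij: "i < 2 * 2" "j < 2 * 2" using carr by simp_all
    note lt = product_index_div_mod[OF ij(1)] product_index_div_mod[OF ij(2)]
    show ?case
      using ij carr c
      by (simp add: tensor_mat_index[of _ 2 _ 2] P(3,4)[OF lt(1,3)] Q(3,4)[OF lt(2,4)] algebra_simps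
          del: index_one_mat(1))
  qed (use carr c in simp_all)
  moreover have "?R \<in> sep_cone 2 2"
    by (intro sep_cone_add sep_cone_smult sep_cone_tensor_mat P(1,2) Q(1,2) nonneg)
  ultimately show ?thesis by simp
qed

section \<open>Maps that are diagonal in a Pauli-type basis\<close>

context pauli_basis
begin

lemma diagonal_map:
  assumes F: "linear_superoperator 2 F" and diag: "\<And>j. j < 4 \<Longrightarrow> F (\<sigma> j) = of_real (\<mu> j) \<cdot>\<^sub>m \<sigma> j"
    and X: "X \<in> carrier_mat 2 2" and rc: "r < 2" "c < 2"
  shows "F X $$ (r, c) = (\<Sum>j<4. of_real (\<mu> j) * mat_trace (X * \<sigma> j) / 2 * \<sigma> j $$ (r, c))"
proof -
  have "X = mat 2 2 (\<lambda>ij. \<Sum>j<4. mat_trace (X * \<sigma> j) / 2 * \<sigma> j $$ ij)"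
    using X by (intro eq_matI) (auto simp: expand[OF X])
  then have "F X = F (mat 2 2 (\<lambda>ij. \<Sum>j<4. mat_trace (X * \<sigma> j) / 2 * \<sigma> j $$ ij))"
    by (rule arg_cong)
  also have "\<dots> = mat 2 2 (\<lambda>ij. \<Sum>j<4. mat_trace (X * \<sigma> j) / 2 * F (\<sigma> j) $$ ij)"
    by (rule linear_superoperator_sum[OF F]) (auto simp: carrier)
  finally have "F X $$ (r, c) = (\<Sum>j<4. mat_trace (X * \<sigma> j) / 2 * F (\<sigma> j) $$ (r, c))"
    using rc by simp
  also have "\<dots> = (\<Sum>j<4. of_real (\<mu> j) * mat_trace (X * \<sigma> j) / 2 * \<sigma> j $$ (r, c))"
    using rc by (intro sum.cong refl) (simp add: diag carrier_matD[OF carrier])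
  finally show ?thesis .
qed

lemma diagonal_map_trace:
  assumes F: "linear_superoperator 2 F" and diag: "\<And>j. j < 4 \<Longrightarrow> F (\<sigma> j) = of_real (\<mu> j) \<cdot>\<^sub>m \<sigma> j"
    and X: "X \<in> carrier_mat 2 2" and k: "k < 4"
  shows "mat_trace (F X * \<sigma> k) = of_real (\<mu> k) * mat_trace (X * \<sigma> k)"
proof -
  let ?a = "\<lambda>j. of_real (\<mu> j) * mat_trace (X * \<sigma> j) / 2"
  have "mat_trace (F X * \<sigma> k) = (\<Sum>r<2. \<Sum>c<2. \<Sum>j<4. ?a j * (\<sigma> j $$ (r, c) * \<sigma> k $$ (c, r)))"
    by (simp add: mat_trace_mult[OF linear_superoperator_carrier[OF F X] carrier[OF k]]
        diagonal_map[OF F diag X] sum_distrib_right mult.assoc del: sum.lessThan_Suc)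
  also have "\<dots> = (\<Sum>j<4. \<Sum>r<2. \<Sum>c<2. ?a j * (\<sigma> j $$ (r, c) * \<sigma> k $$ (c, r)))"
    by (subst sum.swap[of _ "{..<2}" "{..<4}"]) (rule sum.cong[OF refl], rule sum.swap)
  also have "\<dots> = (\<Sum>j<4. ?a j * mat_trace (\<sigma> j * \<sigma> k))"
    using k by (intro sum.cong refl) (simp add: mat_trace_mult[OF carrier carrier] sum_distrib_left)
  also have "\<dots> = (\<Sum>j<4. if j = k then 2 * ?a j else 0)"
    using k by (intro sum.cong refl) (simp add: orthogonal)
  finally show ?thesis using k by simp
qed

lemma diagonal_map_traceless_hermitian:
  assumes F: "linear_superoperator 2 F" and diag: "\<And>j. j < 4 \<Longrightarrow> F (\<sigma> j) = of_real (\<mu> j) \<cdot>\<^sub>m \<sigma> j"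
    and X: "traceless_hermitian X"
  shows "traceless_hermitian (F X)"
proof -
  have Xc: "X \<in> carrier_mat 2 2" and Xh: "self_adjoint X" and Xt: "mat_trace X = 0"
    using X by (auto simp: traceless_hermitian_def)
  have FX: "F X \<in> carrier_mat 2 2" by (rule linear_superoperator_carrier[OF F Xc])
  have "mat_trace (F X) = 0"
    using diagonal_map_trace[OF F diag Xc, of 0] FX Xc Xt by (simp add: zero)
  moreover have "self_adjoint (F X)"
    unfolding self_adjoint_iff[OF FX]
  proof (intro allI impI)
    fix i j :: nat assume ij: "i < 2" "j < 2"
    have "cnj (F X $$ (j, i)) = (\<Sum>k<4. of_real (\<mu> k) * cnj (mat_trace (X * \<sigma> k)) / 2 * cnj (\<sigma> k $$ (j, i)))"
      using ij by (simp add: diagonal_map[OF F diag Xc] del: sum.lessThan_Suc)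
    also have "\<dots> = (\<Sum>k<4. of_real (\<mu> k) * mat_trace (X * \<sigma> k) / 2 * \<sigma> k $$ (i, j))"
    proof (intro sum.cong refl)
      fix k :: nat assume "k \<in> {..<4}"
      then have k: "k < 4" by simp
      have "cnj (mat_trace (X * \<sigma> k)) = mat_trace (X * \<sigma> k)"
        using mat_trace_mult_Reals[OF Xc carrier[OF k] Xh hermitian[OF k]] by (simp add: Reals_cnj_iff)
      moreover have "\<sigma> k $$ (i, j) = cnj (\<sigma> k $$ (j, i))"
        using hermitian[OF k] ij unfolding self_adjoint_iff[OF carrier[OF k]] by blast
      ultimately show "of_real (\<mu> k) * cnj (mat_trace (X * \<sigma> k)) / 2 * cnj (\<sigma> k $$ (j, i))
          = of_real (\<mu> k) * mat_trace (X * \<sigma> k) / 2 * \<sigma> k $$ (i, j)" by simp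
    qed
    finally show "F X $$ (i, j) = cnj (F X $$ (j, i))"
      using diagonal_map[OF F diag Xc ij] by simp
  qed
  ultimately show ?thesis using FX by (simp add: traceless_hermitian_def)
qed

text \<open>Both sides are the squared Hilbert-Schmidt norm of \<open>F\<close> on the traceless
  operators, computed in two different bases.\<close>

lemma diagonal_map_norms:
  assumes F: "linear_superoperator 2 F" and diag: "\<And>j. j < 4 \<Longrightarrow> F (\<sigma> j) = of_real (\<mu> j) \<cdot>\<^sub>m \<sigma> j"
    and \<tau>: "pauli_basis \<tau>"
  shows "(\<Sum>k\<in>{1..3}. (bloch_norm (F (\<tau> k)))\<^sup>2) = (\<Sum>j\<in>{1..3}. (\<mu> j)\<^sup>2)"
proof -
  interpret \<tau>: pauli_basis \<tau> by fact
  let ?t = "\<lambda>k j. mat_trace (\<tau> k * \<sigma> j)"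
  \<comment> \<open>Parseval for \<open>\<sigma> j\<close> in the basis \<open>\<tau>\<close>; the
    component along the identity is 0.\<close>
  have col: "(\<Sum>k\<in>{1..3}. (?t k j)\<^sup>2) = 4" if "j \<in> {1..3}" for j
  proof -
    have j: "j < 4" using that by simp
    have "2 = (\<Sum>k<4. mat_trace (\<sigma> j * \<tau> k) * mat_trace (\<sigma> j * \<tau> k)) / 2"
      using \<tau>.parseval[OF carrier[OF j] carrier[OF j]] orthogonal[OF j j] by simp
    also have "\<dots> = (\<Sum>k<4. (?t k j)\<^sup>2) / 2"
      using j by (intro arg_cong[of _ _ "\<lambda>x. x / 2"] sum.cong refl)
        (simp add: power2_eq_square mat_trace_mult_commute[OF carrier \<tau>.carrier])
    also have "?t 0 j = 0"
      using carrier[OF j] traceless[OF that] by (simp add: \<tau>.zero)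
    then have "(\<Sum>k<4. (?t k j)\<^sup>2) = (\<Sum>k\<in>{1..3}. (?t k j)\<^sup>2)" by (simp add: sum_lessThan_4_split)
    finally show ?thesis by simp
  qed
  \<comment> \<open>Parseval for \<open>F (\<tau> k)\<close> in the basis \<open>\<sigma>\<close>,
    where \<open>F\<close> scales each coordinate.\<close>
  have row: "mat_trace (F (\<tau> k) * F (\<tau> k)) = (\<Sum>j\<in>{1..3}. of_real ((\<mu> j)\<^sup>2) * (?t k j)\<^sup>2) / 2" if "k \<in> {1..3}" for k
  proof -
    have k: "k < 4" using that by simp
    note c = \<tau>.carrier[OF k]
    have "?t k 0 = 0" using c \<tau>.traceless[OF that] by (simp add: zero)
    then show ?thesis
      unfolding parseval[OF linear_superoperator_carrier[OF F c] linear_superoperator_carrier[OF F c]]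
        sum_lessThan_4_split
      by (simp add: diagonal_map_trace[OF F diag c] power2_eq_square mult_ac)
  qed
  have "complex_of_real (\<Sum>k\<in>{1..3}. 2 * (bloch_norm (F (\<tau> k)))\<^sup>2)
      = (\<Sum>k\<in>{1..3}. mat_trace (F (\<tau> k) * F (\<tau> k)))"
    unfolding of_real_sum
    by (intro sum.cong refl)
      (metis diagonal_map_traceless_hermitian[OF F diag \<tau>.traceless_hermitian] traceless_hermitian_entries)
  also have "\<dots> = (\<Sum>k\<in>{1..3}. \<Sum>j\<in>{1..3}. of_real ((\<mu> j)\<^sup>2) * (?t k j)\<^sup>2 / 2)"
    by (simp add: row sum_divide_distrib)
  also have "\<dots> = (\<Sum>j\<in>{1..3}. of_real ((\<mu> j)\<^sup>2) / 2 * (\<Sum>k\<in>{1..3}. (?t k j)\<^sup>2))"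
    by (subst sum.swap) (simp add: sum_distrib_left)
  also have "\<dots> = (\<Sum>j\<in>{1..3}. of_real ((\<mu> j)\<^sup>2) / 2 * 4)"
    by (rule sum.cong[OF refl]) (simp only: col)
  also have "\<dots> = complex_of_real (\<Sum>j\<in>{1..3}. 2 * (\<mu> j)\<^sup>2)" by simp
  finally have "(\<Sum>k\<in>{1..3}. 2 * (bloch_norm (F (\<tau> k)))\<^sup>2) = (\<Sum>j\<in>{1..3}. 2 * (\<mu> j)\<^sup>2)"
    unfolding of_real_eq_iff .
  then show ?thesis by (simp flip: sum_distrib_left)
qed

end

section \<open>Entanglement-breaking squares\<close>

lemma mat_trace_matrix_unit_mult:
  assumes "Y \<in> carrier_mat d d" "i < d" "j < d"
  shows "mat_trace (matrix_unit d i j * Y) = Y $$ (j, i)"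
proof -
  have "mat_trace (matrix_unit d i j * Y) = (\<Sum>r<d. \<Sum>c<d. if r = i \<and> c = j then Y $$ (c, r) else 0)"
    unfolding mat_trace_mult[OF matrix_unit_carrier assms(1)] by (intro sum.cong refl) auto
  also have "\<dots> = Y $$ (j, i)" by (rule sum_double_delta) (use assms in auto)
  finally show ?thesis .
qed

lemma (in pauli_basis) diagonal_map_matrix_unit:
  assumes F: "linear_superoperator 2 F" and diag: "\<And>j. j < 4 \<Longrightarrow> F (\<sigma> j) = of_real (\<mu> j) \<cdot>\<^sub>m \<sigma> j"
    and "r < 2" "c < 2" "i < 2" "j < 2"
  shows "F (matrix_unit 2 i j) $$ (r, c) = (\<Sum>s<4. of_real (\<mu> s) / 2 * (\<sigma> s $$ (j, i) * \<sigma> s $$ (r, c)))"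
  using assms carrier
  by (simp add: diagonal_map[OF F diag matrix_unit_carrier] mat_trace_matrix_unit_mult[OF carrier] mult.assoc)

text \<open>With the sign-twisted flip \<open>\<gamma>\<close> of \<open>\<beta>\<close>, the gap in the inequality is the sum of the entries
  of the Schur product of \<open>\<alpha>\<close> and \<open>\<gamma>\<close>.\<close>

lemma quantum_state_overlap_le:
  assumes "quantum_state 2 \<alpha>" "quantum_state 2 \<beta>"
  shows "(\<Sum>i<2. \<Sum>j<2. \<alpha> $$ (i, j) * \<beta> $$ (i, j)) \<le> 1"
proof -
  have \<alpha>: "\<alpha> \<in> carrier_mat 2 2" "psd_kernel {..<2} (\<lambda>r c. \<alpha> $$ (r, c))" "mat_trace \<alpha> = 1"
    and \<beta>: "\<beta> \<in> carrier_mat 2 2" "psd_kernel {..<2} (\<lambda>r c. \<beta> $$ (r, c))" "mat_trace \<beta> = 1"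
    using assms by (auto simp: quantum_state_def positive_semidefinite_iff)
  let ?s = "\<lambda>r::nat. (- 1) ^ r :: complex"
  define \<gamma> where "\<gamma> r c = \<beta> $$ (1 - c, 1 - r) * (?s r * cnj (?s c))" for r c
  have "psd_kernel {..<2} (\<lambda>r c. \<beta> $$ (1 - c, 1 - r))"
    by (rule psd_kernel_pullback[OF psd_kernel_transpose[OF \<beta>(2)], of "{..<2}" "\<lambda>r. 1 - r"]) auto
  from psd_kernel_schur_product[OF finite_lessThan this psd_kernel_rank_one[of _ ?s]]
  have "psd_kernel {..<2} \<gamma>" unfolding \<gamma>_def .
  from psd_kernelD[OF psd_kernel_schur_product[OF finite_lessThan \<alpha>(2) this], of "\<lambda>_. 1"]
  have "0 \<le> \<alpha> $$ (0, 0) * \<beta> $$ (1, 1) + \<alpha> $$ (1, 1) * \<beta> $$ (0, 0)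
      - \<alpha> $$ (0, 1) * \<beta> $$ (0, 1) - \<alpha> $$ (1, 0) * \<beta> $$ (1, 0)"
    by (simp add: lessThan_2 \<gamma>_def algebra_simps)
  also have "\<dots> = (\<alpha> $$ (0, 0) + \<alpha> $$ (1, 1)) * (\<beta> $$ (0, 0) + \<beta> $$ (1, 1))
      - (\<Sum>i<2. \<Sum>j<2. \<alpha> $$ (i, j) * \<beta> $$ (i, j))"
    by (simp add: lessThan_2 algebra_simps)
  also have "\<dots> = 1 - (\<Sum>i<2. \<Sum>j<2. \<alpha> $$ (i, j) * \<beta> $$ (i, j))"
    using \<alpha>(3) \<beta>(3) by (simp add: mat_trace_carrier[OF \<alpha>(1)] mat_trace_carrier[OF \<beta>(1)] lessThan_2)
  finally show ?thesis by simp
qed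

text \<open>The sum is twice the overlap with the Bell state. It is linear in \<open>\<rho>\<close>,
  so convexity reduces the bound to product states, that is, to
  \<open>quantum_state_overlap_le\<close>.\<close>

lemma separable_bell_overlap_le:
  assumes "separable 2 2 \<rho>"
  shows "Re (\<Sum>i<2. \<Sum>j<2. \<rho> $$ (i * 2 + i, j * 2 + j)) \<le> 1"
proof -
  obtain K :: nat and p \<alpha> \<beta> where st: "\<forall>k<K. (0::real) \<le> p k \<and> quantum_state 2 (\<alpha> k) \<and> quantum_state 2 (\<beta> k)"
    and p: "(\<Sum>k<K. p k) = 1"
    and eq: "\<rho> = mat (2 * 2) (2 * 2)
               (\<lambda>(r, c). \<Sum>k<K. complex_of_real (p k) * tensor_mat (\<alpha> k) (\<beta> k) $$ (r, c))"
    using assms unfolding separable_def by blast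
  have carr: "\<alpha> k \<in> carrier_mat 2 2" "\<beta> k \<in> carrier_mat 2 2" if "k < K" for k
    using st that by (auto simp: quantum_state_def positive_semidefinite_carrier)
  have entry: "\<rho> $$ (i * 2 + i, j * 2 + j)
      = (\<Sum>k<K. complex_of_real (p k) * (\<alpha> k $$ (i, j) * \<beta> k $$ (i, j)))" if "i < 2" "j < 2" for i j
  proof -
    have ij: "i * 2 + i < 2 * 2" "j * 2 + j < 2 * 2" using that by auto
    have dm: "(i * 2 + i) div 2 = i" "(j * 2 + j) div 2 = j" "(i * 2 + i) mod 2 = i" "(j * 2 + j) mod 2 = j"
      using that by (auto simp: less_2_cases_iff)
    have "\<rho> $$ (i * 2 + i, j * 2 + j)
        = (\<Sum>k<K. complex_of_real (p k) * tensor_mat (\<alpha> k) (\<beta> k) $$ (i * 2 + i, j * 2 + j))"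
      unfolding eq index_mat(1)[OF ij] by simp
    also have "\<dots> = (\<Sum>k<K. complex_of_real (p k) * (\<alpha> k $$ (i, j) * \<beta> k $$ (i, j)))"
      by (rule sum.cong[OF refl]) (simp only: lessThan_iff tensor_mat_index[OF carr ij] dm)
    finally show ?thesis .
  qed
  have "(\<Sum>i<2. \<Sum>j<2. \<rho> $$ (i * 2 + i, j * 2 + j))
      = (\<Sum>k<K. complex_of_real (p k) * (\<Sum>i<2. \<Sum>j<2. \<alpha> k $$ (i, j) * \<beta> k $$ (i, j)))"
  proof -
    have "(\<Sum>i<2. \<Sum>j<2. \<rho> $$ (i * 2 + i, j * 2 + j))
        = (\<Sum>i<2. \<Sum>j<2. \<Sum>k<K. complex_of_real (p k) * (\<alpha> k $$ (i, j) * \<beta> k $$ (i, j)))"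
      by (intro sum.cong refl) (simp only: entry lessThan_iff)
    also have "\<dots> = (\<Sum>k<K. \<Sum>i<2. \<Sum>j<2. complex_of_real (p k) * (\<alpha> k $$ (i, j) * \<beta> k $$ (i, j)))"
      by (subst sum.swap[of _ "{..<2}" "{..<K}"]) (rule sum.cong[OF refl], rule sum.swap)
    finally show ?thesis by (simp add: sum_distrib_left)
  qed
  then have "Re (\<Sum>i<2. \<Sum>j<2. \<rho> $$ (i * 2 + i, j * 2 + j))
      = (\<Sum>k<K. p k * Re (\<Sum>i<2. \<Sum>j<2. \<alpha> k $$ (i, j) * \<beta> k $$ (i, j)))" by simp
  also have "\<dots> \<le> (\<Sum>k<K. p k * 1)"
  proof (rule sum_mono)
    fix k assume "k \<in> {..<K}"
    then show "p k * Re (\<Sum>i<2. \<Sum>j<2. \<alpha> k $$ (i, j) * \<beta> k $$ (i, j)) \<le> p k * 1"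
      using st quantum_state_overlap_le[of "\<alpha> k" "\<beta> k"]
      by (intro mult_left_mono) (auto simp: less_eq_complex_def)
  qed
  finally show ?thesis using p by simp
qed

text \<open>The Bell state is the test input: the overlap of its image with itself is a quarter of
  the sum of the \<open>\<mu> j\<close>.\<close>

lemma (in pauli_basis) entanglement_breaking_imp_sum_le:
  assumes EB: "entanglement_breaking 2 F"
    and diag: "\<And>j. j < 4 \<Longrightarrow> F (\<sigma> j) = of_real (\<mu> j) \<cdot>\<^sub>m \<sigma> j"
  shows "(\<Sum>j<4. \<mu> j) \<le> 2"
proof -
  have F: "linear_superoperator 2 F"
    using EB by (simp add: entanglement_breaking_def quantum_channel_def)
  let ?\<omega> = "\<lambda>r::nat. if r div 2 = r mod 2 then 1 else 0 :: complex"
  define \<rho> where "\<rho> = mat (2 * 2) (2 * 2) (\<lambda>(r, c). of_real (1 / 2) * (?\<omega> r * cnj (?\<omega> c)))"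
  have "positive_semidefinite (2 * 2) \<rho>"
    unfolding positive_semidefinite_iff
  proof
    have "psd_kernel {..<2 * 2} (\<lambda>r c. of_real (1 / 2) * (?\<omega> r * cnj (?\<omega> c)))"
      by (intro psd_kernel_scale psd_kernel_rank_one) simp
    then show "psd_kernel {..<2 * 2} (\<lambda>r c. \<rho> $$ (r, c))"
      by (rule psd_kernel_cong) (simp add: \<rho>_def)
  qed (simp add: \<rho>_def)
  moreover have "mat_trace \<rho> = 1" by (simp add: mat_trace_def \<rho>_def lessThan_4)
  ultimately have "separable 2 2 (tensor_map 2 2 F (\<lambda>Y. Y) \<rho>)"
    using EB by (simp add: entanglement_breaking_def quantum_state_def)
  from separable_bell_overlap_le[OF this]
  have le: "Re (\<Sum>i<2. \<Sum>j<2. tensor_map 2 2 F (\<lambda>Y. Y) \<rho> $$ (i * 2 + i, j * 2 + j)) \<le> 1" .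
  have entry: "tensor_map 2 2 F (\<lambda>Y. Y) \<rho> $$ (i * 2 + i, j * 2 + j)
      = (\<Sum>s<4. of_real (\<mu> s) / 4 * (\<sigma> s $$ (i, j) * \<sigma> s $$ (j, i)))" if ij: "i < 2" "j < 2" for i j
  proof -
    have lt: "i * 2 + i < 2 * 2" "j * 2 + j < 2 * 2" using ij by auto
    have dm: "(i * 2 + i) div 2 = i" "(j * 2 + j) div 2 = j" "(i * 2 + i) mod 2 = i" "(j * 2 + j) mod 2 = j"
      using ij by (auto simp: less_2_cases_iff)
    have "tensor_map 2 2 F (\<lambda>Y. Y) \<rho> $$ (i * 2 + i, j * 2 + j)
      = (\<Sum>k<2. \<Sum>l<2. if k = i \<and> l = j then F (matrix_unit 2 k l) $$ (i, j) / 2 else 0)"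
      unfolding tensor_map_id_index[OF F lt] dm
    proof (intro sum.cong refl)
      fix k l :: nat assume "k \<in> {..<2}" "l \<in> {..<2}"
      then have "k * 2 + i < 2 * 2" "l * 2 + j < 2 * 2" "(k * 2 + i) div 2 = k" "(k * 2 + i) mod 2 = i"
        "(l * 2 + j) div 2 = l" "(l * 2 + j) mod 2 = j"
        using ij by (auto simp: less_2_cases_iff)
      then show "F (matrix_unit 2 k l) $$ (i, j) * \<rho> $$ (k * 2 + i, l * 2 + j)
          = (if k = i \<and> l = j then F (matrix_unit 2 k l) $$ (i, j) / 2 else 0)"
        by (simp add: \<rho>_def)
    qed
    also have "\<dots> = F (matrix_unit 2 i j) $$ (i, j) / 2"
      by (rule sum_double_delta) (use ij in auto)
    finally show ?thesis
      using ij by (simp add: diagonal_map_matrix_unit[OF F diag] sum_divide_distrib mult_ac)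
  qed
  have "(\<Sum>i<2. \<Sum>j<2. tensor_map 2 2 F (\<lambda>Y. Y) \<rho> $$ (i * 2 + i, j * 2 + j))
      = (\<Sum>i<2. \<Sum>j<2. \<Sum>s<4. of_real (\<mu> s) / 4 * (\<sigma> s $$ (i, j) * \<sigma> s $$ (j, i)))"
    by (intro sum.cong refl) (simp only: entry lessThan_iff)
  also have "\<dots> = (\<Sum>s<4. \<Sum>i<2. \<Sum>j<2. of_real (\<mu> s) / 4 * (\<sigma> s $$ (i, j) * \<sigma> s $$ (j, i)))"
    by (subst sum.swap[of _ "{..<2}" "{..<4}"]) (rule sum.cong[OF refl], rule sum.swap)
  also have "\<dots> = (\<Sum>s<4. of_real (\<mu> s) / 4 * mat_trace (\<sigma> s * \<sigma> s))"
    by (intro sum.cong refl) (simp add: mat_trace_mult[OF carrier carrier] sum_distrib_left)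
  also have "\<dots> = of_real ((\<Sum>s<4. \<mu> s) / 2)"
    by (simp add: orthogonal sum_divide_distrib)
  finally have eq: "(\<Sum>i<2. \<Sum>j<2. tensor_map 2 2 F (\<lambda>Y. Y) \<rho> $$ (i * 2 + i, j * 2 + j))
      = of_real ((\<Sum>s<4. \<mu> s) / 2)" .
  show ?thesis using le unfolding eq by simp
qed

text \<open>The output is half the sum of the products of \<open>\<mu> s\<close>,
  \<open>\<sigma> s\<close> and \<open>R (\<sigma> s)\<close>. For \<open>s\<close> from 1 to 3 the
  term is paired with a share \<open>\<mu> s\<close> of the identity term; together they measure
  along \<open>\<sigma> s\<close> and prepare the eigenstate found. The rest of the identity term is
  already a product.\<close>

lemma (in pauli_basis) entanglement_breaking_if_sum_le:
  assumes ch: "quantum_channel 2 F"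
    and diag: "\<And>j. j < 4 \<Longrightarrow> F (\<sigma> j) = of_real (\<mu> j) \<cdot>\<^sub>m \<sigma> j"
    and "\<mu> 0 = 1" and nonneg: "\<And>j. j \<in> {1..3} \<Longrightarrow> 0 \<le> \<mu> j" and le: "(\<Sum>j\<in>{1..3}. \<mu> j) \<le> 1"
  shows "entanglement_breaking 2 F"
  unfolding entanglement_breaking_def
proof (intro conjI allI impI ch)
  fix n \<rho> assume \<rho>: "quantum_state (2 * n) \<rho>"
  have F: "linear_superoperator 2 F" using ch by (simp add: quantum_channel_def)
  have \<rho>c: "\<rho> \<in> carrier_mat (2 * n) (2 * n)" and \<rho>p: "psd_kernel {..<2 * n} (\<lambda>r c. \<rho> $$ (r, c))"
    using \<rho> by (auto simp: quantum_state_def positive_semidefinite_iff)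
  \<comment> \<open>\<open>R M\<close> is the partial trace over the system of \<open>\<rho>\<close>
    multiplied by \<open>M\<close> on the system, for positive \<open>M\<close> the unnormalised
    ancilla state after an outcome with effect \<open>M\<close>.\<close>
  define R where "R M = mat n n (\<lambda>(k, l). \<Sum>i<2. \<Sum>j<2. M $$ (j, i) * \<rho> $$ (i * n + k, j * n + l))"
    for M :: "complex mat"
  have R: "positive_semidefinite n (R M)" if "positive_semidefinite 2 M" for M
  proof -
    let ?S = "{..<n} \<times> {..<2::nat}"
    have M: "psd_kernel {..<2} (\<lambda>r c. M $$ (c, r))"
      using that by (simp add: positive_semidefinite_iff psd_kernel_transpose)
    have K1: "psd_kernel ?S (\<lambda>p q. M $$ (snd q, snd p))"
      by (rule psd_kernel_pullback[OF M, of ?S snd]) auto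
    have K2: "psd_kernel ?S (\<lambda>p q. \<rho> $$ (snd p * n + fst p, snd q * n + fst q))"
      by (rule psd_kernel_pullback[OF \<rho>p, of ?S "\<lambda>p. snd p * n + fst p"]) (auto intro!: product_index_less)
    have "psd_kernel ?S (\<lambda>(k, i) (l, j). M $$ (j, i) * \<rho> $$ (i * n + k, j * n + l))"
      using psd_kernel_schur_product[OF _ K1 K2] by (simp add: case_prod_unfold)
    from psd_kernel_marginal[OF this] show ?thesis
      unfolding positive_semidefinite_iff
      by (auto simp: R_def intro: psd_kernel_cong)
  qed
  \<comment> \<open>Twice the eigenprojections of \<open>\<sigma> j\<close>, which has Bloch length
    1. The surplus factors are absorbed by the coefficients \<open>\<mu> j / 4\<close>
    below.\<close>
  let ?P = "\<lambda>j. of_real 1 \<cdot>\<^sub>m 1\<^sub>m 2 + \<sigma> j" and ?N = "\<lambda>j. of_real 1 \<cdot>\<^sub>m 1\<^sub>m 2 - \<sigma> j"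
  let ?D = "\<lambda>j. tensor_mat (?P j) (R (?P j)) + tensor_mat (?N j) (R (?N j))"
  have PN: "positive_semidefinite 2 (?P j)" "positive_semidefinite 2 (?N j)" if "j \<in> {1..3}" for j
  proof -
    have "mat_trace (\<sigma> j * \<sigma> j) = 2" using orthogonal[of j j] that by simp
    then have "bloch_norm (\<sigma> j) \<le> 1" by (simp add: bloch_norm_def)
    then show "positive_semidefinite 2 (?P j)" "positive_semidefinite 2 (?N j)"
      using positive_semidefinite_add_traceless[OF traceless_hermitian[OF that]] by blast+
  qed
  have one: "positive_semidefinite 2 (1\<^sub>m 2)"
    by (rule positive_semidefinite_2x2[of _ 1 1 0]) auto
  have eq: "tensor_map 2 n F (\<lambda>Y. Y) \<rho> =
      of_real ((1 - (\<Sum>j\<in>{1..3}. \<mu> j)) / 2) \<cdot>\<^sub>m tensor_mat (1\<^sub>m 2) (R (1\<^sub>m 2))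
      + of_real (\<mu> 1 / 4) \<cdot>\<^sub>m ?D 1 + of_real (\<mu> 2 / 4) \<cdot>\<^sub>m ?D 2 + of_real (\<mu> 3 / 4) \<cdot>\<^sub>m ?D 3"
    (is "_ = ?E")
  proof (rule eq_matI, goal_cases)
    case (1 r c)
    have Rc: "R M \<in> carrier_mat n n" for M by (simp add: R_def)
    have c3: "\<sigma> 1 \<in> carrier_mat 2 2" "\<sigma> 2 \<in> carrier_mat 2 2" "\<sigma> 3 \<in> carrier_mat 2 2" by (simp_all add: carrier)
    have rc: "r < 2 * n" "c < 2 * n" using 1 c3 by (simp_all add: R_def)
    note lt = product_index_div_mod[OF rc(1)] product_index_div_mod[OF rc(2)]
    have RP: "R (?P j) $$ (r mod n, c mod n) = R (1\<^sub>m 2) $$ (r mod n, c mod n) + R (\<sigma> j) $$ (r mod n, c mod n)"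
      "R (?N j) $$ (r mod n, c mod n) = R (1\<^sub>m 2) $$ (r mod n, c mod n) - R (\<sigma> j) $$ (r mod n, c mod n)"
      if "\<sigma> j \<in> carrier_mat 2 2" for j
      using lt that by (simp_all add: R_def lessThan_2 algebra_simps)
    have D: "?D j $$ (r, c) = 2 * (1\<^sub>m 2 $$ (r div n, c div n) * R (1\<^sub>m 2) $$ (r mod n, c mod n)
        + \<sigma> j $$ (r div n, c div n) * R (\<sigma> j) $$ (r mod n, c mod n))" if j: "\<sigma> j \<in> carrier_mat 2 2" for j
    proof -
      have "?P j \<in> carrier_mat 2 2" "?N j \<in> carrier_mat 2 2" using j by (simp_all add: minus_carrier_mat)
      note T = tensor_mat_index[OF this(1) Rc rc] tensor_mat_index[OF this(2) Rc rc]
      have "?D j $$ (r, c) = tensor_mat (?P j) (R (?P j)) $$ (r, c) + tensor_mat (?N j) (R (?N j)) $$ (r, c)"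
        using rc j by (intro index_add_mat(1)) (simp_all add: carrier_matD[OF Rc])
      also have "\<dots> = 2 * (1\<^sub>m 2 $$ (r div n, c div n) * R (1\<^sub>m 2) $$ (r mod n, c mod n)
        + \<sigma> j $$ (r div n, c div n) * R (\<sigma> j) $$ (r mod n, c mod n))"
        unfolding T RP[OF j] using j lt by (simp add: algebra_simps del: index_one_mat(1))
      finally show ?thesis .
    qed
    have E: "?E $$ (r, c) = of_real ((1 - (\<Sum>j\<in>{1..3}. \<mu> j)) / 2) * tensor_mat (1\<^sub>m 2) (R (1\<^sub>m 2)) $$ (r, c)
      + of_real (\<mu> 1 / 4) * ?D 1 $$ (r, c) + of_real (\<mu> 2 / 4) * ?D 2 $$ (r, c) + of_real (\<mu> 3 / 4) * ?D 3 $$ (r, c)"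
      using rc c3 by (simp add: carrier_matD[OF Rc])
    have "tensor_map 2 n F (\<lambda>Y. Y) \<rho> $$ (r, c) = (\<Sum>i<2. \<Sum>j<2. (\<Sum>s<4. of_real (\<mu> s) / 2 *
        (\<sigma> s $$ (j, i) * \<sigma> s $$ (r div n, c div n))) * \<rho> $$ (i * n + r mod n, j * n + c mod n))"
      unfolding tensor_map_id_index[OF F rc]
      using lt by (intro sum.cong refl) (simp add: diagonal_map_matrix_unit[OF F diag])
    also have "\<dots> = (\<Sum>i<2. \<Sum>j<2. \<Sum>s<4. of_real (\<mu> s) / 2 * \<sigma> s $$ (r div n, c div n) *
        (\<sigma> s $$ (j, i) * \<rho> $$ (i * n + r mod n, j * n + c mod n)))"
      by (simp add: sum_distrib_left sum_distrib_right mult_ac)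
    also have "\<dots> = (\<Sum>s<4. \<Sum>i<2. \<Sum>j<2. of_real (\<mu> s) / 2 * \<sigma> s $$ (r div n, c div n) *
        (\<sigma> s $$ (j, i) * \<rho> $$ (i * n + r mod n, j * n + c mod n)))"
      by (subst sum.swap[of _ "{..<2}" "{..<4}"]) (rule sum.cong[OF refl], rule sum.swap)
    also have "\<dots> = (\<Sum>s<4. of_real (\<mu> s) / 2 * \<sigma> s $$ (r div n, c div n) * R (\<sigma> s) $$ (r mod n, c mod n))"
      using lt by (simp add: R_def sum_distrib_left)
    also have "\<dots> = ?E $$ (r, c)"
      unfolding E D[OF c3(1)] D[OF c3(2)] D[OF c3(3)] tensor_mat_index[OF one_carrier_mat Rc rc]
      unfolding atLeastAtMost_1_3
      by (simp add: \<open>\<mu> 0 = 1\<close> zero lessThan_4 field_simps del: index_one_mat(1))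
    finally show ?case .
  qed (simp_all add: R_def carrier_matD[OF carrier] carrier_matD[OF tensor_map_carrier])
  have "?E \<in> sep_cone 2 n"
    using le nonneg
    by (intro sep_cone_add sep_cone_smult sep_cone_tensor_mat R one PN) auto
  moreover have "mat_trace (tensor_map 2 n F (\<lambda>Y. Y) \<rho>) = 1"
    using quantum_channel_tensor_map[OF ch quantum_channel_id] \<rho> \<rho>c
    by (simp add: quantum_channel_def trace_preserving_def quantum_state_def)
  ultimately show "separable 2 n (tensor_map 2 n F (\<lambda>Y. Y) \<rho>)"
    unfolding eq by (rule separable_if_sep_cone)
qed

section \<open>Schmidt decomposition\<close>

definition orthonormal_pair :: "(nat \<Rightarrow> complex) \<Rightarrow> (nat \<Rightarrow> complex) \<Rightarrow> bool" where
  "orthonormal_pair e f \<longleftrightarrow> e 0 * cnj (e 0) + e 1 * cnj (e 1) = 1 \<and> f 0 * cnj (f 0) + f 1 * cnj (f 1) = 1 \<and>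
    e 0 * cnj (f 0) + e 1 * cnj (f 1) = 0"

lemma orthonormal_pair_swap: "orthonormal_pair e f \<Longrightarrow> orthonormal_pair f e"
  unfolding orthonormal_pair_def
  by (metis complex_cnj_add complex_cnj_cnj complex_cnj_mult complex_cnj_zero mult.commute)

lemma orthonormal_pair_cnj: "orthonormal_pair e f \<Longrightarrow> orthonormal_pair (\<lambda>i. cnj (e i)) (\<lambda>i. cnj (f i))"
  unfolding orthonormal_pair_def
  by (metis complex_cnj_add complex_cnj_cnj complex_cnj_mult complex_cnj_zero mult.commute)

text \<open>As for \<open>completeness\<close>, orthonormality is a one-sided inverse, hence a
  two-sided one.\<close>

lemma orthonormal_pair_complete:
  assumes "orthonormal_pair e f" "r < 2" "c < 2"
  shows "e r * cnj (e c) + f r * cnj (f c) = (if r = c then 1 else 0)"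
proof -
  define U where "U = mat 2 2 (\<lambda>(r, c). if r = 0 then cnj (e c) else cnj (f c))"
  define V where "V = mat 2 2 (\<lambda>(r, c). if c = 0 then e r else f r)"
  have carr: "U \<in> carrier_mat 2 2" "V \<in> carrier_mat 2 2" by (simp_all add: U_def V_def)
  have "U * V = 1\<^sub>m 2"
    using assms(1) orthonormal_pair_swap[OF assms(1)]
    by (intro eq_matI)
      (auto simp: U_def V_def scalar_prod_def orthonormal_pair_def atLeast0LessThan lessThan_2 less_2_cases_iff mult.commute)
  then have "V * U = 1\<^sub>m 2" by (rule mat_mult_left_right_inverse[OF carr])
  then have "(V * U) $$ (r, c) = (if r = c then 1 else 0)" using assms by simp
  then show ?thesis
    using assms by (simp add: U_def V_def scalar_prod_def atLeast0LessThan lessThan_2)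
qed

text \<open>The Pauli matrices transported to the basis \<open>e\<close>, \<open>f\<close>.\<close>

definition frame :: "(nat \<Rightarrow> complex) \<Rightarrow> (nat \<Rightarrow> complex) \<Rightarrow> nat \<Rightarrow> complex mat" where
  "frame e f j = mat 2 2 (\<lambda>(r, c).
     [1, 0, 0, 1] ! j * (e r * cnj (e c)) + [1, 0, 0, - 1] ! j * (f r * cnj (f c))
     + [0, 1, - \<i>, 0] ! j * (e r * cnj (f c)) + [0, 1, \<i>, 0] ! j * (f r * cnj (e c)))"

lemma frame_carrier [simp]: "frame e f j \<in> carrier_mat 2 2"
  by (simp add: frame_def)

lemma frame_pauli_basis:
  assumes ef: "orthonormal_pair e f"
  shows "pauli_basis (frame e f)"
proof
  let ?E = "e 0 * cnj (e 0) + e 1 * cnj (e 1)" and ?F = "f 0 * cnj (f 0) + f 1 * cnj (f 1)"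
    and ?H = "e 0 * cnj (f 0) + e 1 * cnj (f 1)" and ?K = "f 0 * cnj (e 0) + f 1 * cnj (e 1)"
  have h: "?E = 1" "?F = 1" "?H = 0" "?K = 0"
    using ef orthonormal_pair_swap[OF ef] by (auto simp: orthonormal_pair_def)
  \<comment> \<open>With arbitrary coefficients in the basis \<open>e\<close>, \<open>f\<close>, one
    trace formula covers all pairs of frame elements. It is first a polynomial identity in the inner
    products; orthonormality enters through \<open>h\<close>.\<close>
  define M where "M a b c d = mat 2 2 (\<lambda>(i, j). a * (e i * cnj (e j)) + b * (f i * cnj (f j))
     + c * (e i * cnj (f j)) + d * (f i * cnj (e j)))" for a b c d :: complex
  have "mat_trace (M a b c d * M a' b' c' d') = a * a' * (?E * ?E) + a * b' * (?K * ?H) + a * c' * (?E * ?H) + a * d' * (?K * ?E)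
    + b * a' * (?H * ?K) + b * b' * (?F * ?F) + b * c' * (?H * ?F) + b * d' * (?F * ?K)
    + c * a' * (?H * ?E) + c * b' * (?F * ?H) + c * c' * (?H * ?H) + c * d' * (?F * ?E)
    + d * a' * (?E * ?K) + d * b' * (?K * ?F) + d * c' * (?E * ?F) + d * d' * (?K * ?K)" for a b c d a' b' c' d'
    by (simp add: mat_trace_mult[of _ 2] M_def lessThan_2 algebra_simps)
  then have M: "mat_trace (M a b c d * M a' b' c' d') = a * a' + b * b' + c * d' + d * c'" for a b c d a' b' c' d'
    unfolding h by simp
  have frame: "frame e f j = M ([1, 0, 0, 1] ! j) ([1, 0, 0, - 1] ! j) ([0, 1, - \<i>, 0] ! j) ([0, 1, \<i>, 0] ! j)" for j
    by (simp add: frame_def M_def)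
  have lt4: "j < 4 \<longleftrightarrow> j = 0 \<or> j = 1 \<or> j = 2 \<or> j = 3" for j :: nat by auto
  have "mat_trace (frame e f j * frame e f k) = (if j = k then 2 else 0)" if "j < 4" "k < 4" for j k
    using that unfolding frame M lt4 by (elim disjE) simp_all
  moreover have "self_adjoint (frame e f j)" if "j < 4" for j
    using that unfolding self_adjoint_iff[OF frame_carrier] lt4
    by (elim disjE) (auto simp: frame_def algebra_simps)
  moreover have "frame e f 0 = 1\<^sub>m 2"
    by (intro eq_matI) (auto simp: frame_def orthonormal_pair_complete[OF ef])
  ultimately show "pauli_type_basis (frame e f)"
    by (simp add: pauli_type_basis_def)
qed

lemma orthonormal_pair_exists:
  assumes "e 0 * cnj (e 0) + e 1 * cnj (e 1) = 1"
  shows "orthonormal_pair e (\<lambda>i. if i = 0 then - cnj (e 1) else cnj (e 0))"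
  using assms by (simp add: orthonormal_pair_def algebra_simps)

lemma normalize_vector:
  fixes u :: "nat \<Rightarrow> complex"
  assumes "u 0 \<noteq> 0 \<or> u 1 \<noteq> 0"
  obtains e a where "e 0 * cnj (e 0) + e 1 * cnj (e 1) = 1" "0 < a" "\<And>i. u i = of_real a * e i"
proof -
  define a where "a = sqrt ((cmod (u 0))\<^sup>2 + (cmod (u 1))\<^sup>2)"
  have a2: "a\<^sup>2 = (cmod (u 0))\<^sup>2 + (cmod (u 1))\<^sup>2" by (simp add: a_def)
  have a: "0 < a" using assms unfolding a_def
    by (auto simp: add_pos_nonneg add_nonneg_pos)
  have "u 0 * cnj (u 0) + u 1 * cnj (u 1) = (of_real a)\<^sup>2"
    unfolding of_real_power[symmetric] a2 by (simp only: of_real_add complex_norm_square)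
  then show ?thesis
    using a by (intro that[of "\<lambda>i. u i / of_real a" a])
      (auto simp: power2_eq_square simp flip: add_divide_distrib)
qed

text \<open>A zero vector gets coefficient 0 and any unit vector that completes the pair, so rank
  deficiency causes no trouble in the Schmidt form. Phases go into the unit vectors, which keeps
  \<open>a\<close> and \<open>b\<close> nonnegative.\<close>

lemma orthogonal_vectors_normalize:
  fixes u v :: "nat \<Rightarrow> complex"
  assumes "u 0 * cnj (v 0) + u 1 * cnj (v 1) = 0"
  obtains e f a b where "orthonormal_pair e f" "0 \<le> a" "0 \<le> b"
    "\<And>i. i < 2 \<Longrightarrow> u i = of_real a * e i" "\<And>i. i < 2 \<Longrightarrow> v i = of_real b * f i"
proof -
  let ?perp = "\<lambda>e i::nat. if i = 0 then - cnj (e 1) else cnj (e 0) :: complex"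
  consider "u 0 = 0" "u 1 = 0" "v 0 = 0" "v 1 = 0" | "u 0 = 0" "u 1 = 0" "v 0 \<noteq> 0 \<or> v 1 \<noteq> 0"
    | "u 0 \<noteq> 0 \<or> u 1 \<noteq> 0" "v 0 = 0" "v 1 = 0" | "u 0 \<noteq> 0 \<or> u 1 \<noteq> 0" "v 0 \<noteq> 0 \<or> v 1 \<noteq> 0"
    by blast
  then show ?thesis
  proof cases
    case 1
    have "orthonormal_pair (\<lambda>i. if i = 0 then 1 else 0) (\<lambda>i. if i = 0 then 0 else 1)"
      by (simp add: orthonormal_pair_def)
    then show ?thesis using 1 by (intro that[of _ _ 0 0]) (auto simp: less_2_cases_iff)
  next
    case 2
    then obtain f b where f: "f 0 * cnj (f 0) + f 1 * cnj (f 1) = 1" "0 < b" "\<And>i. v i = of_real b * f i"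
      using normalize_vector by metis
    show ?thesis
      using 2 f by (intro that[OF orthonormal_pair_swap[OF orthonormal_pair_exists[of f]], of 0 b])
        (auto simp: less_2_cases_iff)
  next
    case 3
    then obtain e a where e: "e 0 * cnj (e 0) + e 1 * cnj (e 1) = 1" "0 < a" "\<And>i. u i = of_real a * e i"
      using normalize_vector by metis
    show ?thesis
      using 3 e by (intro that[OF orthonormal_pair_exists[of e], of a 0]) (auto simp: less_2_cases_iff)
  next
    case 4
    obtain e a where e: "e 0 * cnj (e 0) + e 1 * cnj (e 1) = 1" "0 < a" "\<And>i. u i = of_real a * e i"
      using normalize_vector[OF 4(1)] by metis
    obtain f b where f: "f 0 * cnj (f 0) + f 1 * cnj (f 1) = 1" "0 < b" "\<And>i. v i = of_real b * f i"
      using normalize_vector[OF 4(2)] by metis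
    have "of_real (a * b) * (e 0 * cnj (f 0) + e 1 * cnj (f 1)) = 0"
      using assms by (simp add: e(3) f(3) algebra_simps)
    then have "orthonormal_pair e f" using e f by (simp add: orthonormal_pair_def)
    then show ?thesis using e f by (intro that[of e f a b]) auto
  qed
qed

lemma complex_quadratic_root:
  fixes p q r :: complex
  assumes "p \<noteq> 0"
  obtains x where "p * x\<^sup>2 + q * x + r = 0"
proof
  define s where "s = csqrt (q\<^sup>2 - 4 * p * r)"
  have "p * ((s - q) / (2 * p))\<^sup>2 + q * ((s - q) / (2 * p)) + r = (s\<^sup>2 - (q\<^sup>2 - 4 * p * r)) / (4 * p)"
    using assms by (simp add: field_simps power2_eq_square)
  also have "\<dots> = 0" by (simp add: s_def)
  finally show "p * ((s - q) / (2 * p))\<^sup>2 + q * ((s - q) / (2 * p)) + r = 0" .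
qed

text \<open>It suffices to find an orthonormal pair \<open>u\<close>, \<open>v\<close> whose images
  \<open>x\<close>, \<open>y\<close> under the coefficient matrix are orthogonal. As
  \<open>v\<close> is determined by \<open>u\<close>, this is a quadratic equation in the
  coordinates of \<open>u\<close> and is solvable over the complex numbers.\<close>

lemma schmidt_decomposition:
  fixes \<psi> :: "nat \<Rightarrow> nat \<Rightarrow> complex"
  obtains e f g h a b where "orthonormal_pair e f" "orthonormal_pair g h" "0 \<le> a" "0 \<le> b"
    "\<And>i k. i < 2 \<Longrightarrow> k < 2 \<Longrightarrow> \<psi> i k = of_real a * e i * g k + of_real b * f i * h k"
proof -
  define G where "G k l = \<psi> 0 k * cnj (\<psi> 0 l) + \<psi> 1 k * cnj (\<psi> 1 l)" for k l
  obtain w :: "nat \<Rightarrow> complex" where w0: "w 0 \<noteq> 0 \<or> w 1 \<noteq> 0"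
    \<comment> \<open>The equation is homogeneous, so one coordinate may be fixed:
      \<open>w 1 = 1\<close> in general, and \<open>w\<close> the first unit vector if
      \<open>G 0 1\<close> vanishes.\<close>
    and w: "G 0 1 * (w 0)\<^sup>2 + (G 1 1 - G 0 0) * w 0 * w 1 - G 1 0 * (w 1)\<^sup>2 = 0"
  proof (cases "G 0 1 = 0")
    case True
    then have "G 1 0 = 0" unfolding G_def
      by (metis complex_cnj_add complex_cnj_cnj complex_cnj_mult complex_cnj_zero mult.commute)
    with True show ?thesis by (intro that[of "\<lambda>i. if i = 0 then 1 else 0"]) auto
  next
    case False
    then obtain x where "G 0 1 * x\<^sup>2 + (G 1 1 - G 0 0) * x + - G 1 0 = 0"
      using complex_quadratic_root by metis
    then show ?thesis by (intro that[of "\<lambda>i. if i = 0 then x else 1"]) auto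
  qed
  obtain u t where u: "u 0 * cnj (u 0) + u 1 * cnj (u 1) = 1" "0 < t" "\<And>i. w i = of_real t * u i"
    using normalize_vector[OF w0] by metis
  have "(of_real t)\<^sup>2 * (G 0 1 * (u 0)\<^sup>2 + (G 1 1 - G 0 0) * u 0 * u 1 - G 1 0 * (u 1)\<^sup>2) = 0"
    using w unfolding u(3) by (simp add: algebra_simps power2_eq_square)
  then have quad: "G 0 1 * (u 0)\<^sup>2 + (G 1 1 - G 0 0) * u 0 * u 1 - G 1 0 * (u 1)\<^sup>2 = 0"
    using u(2) by simp
  define v where "v = (\<lambda>i::nat. if i = 0 then - cnj (u 1) else cnj (u 0))"
  have uv: "orthonormal_pair u v" unfolding v_def by (rule orthonormal_pair_exists[OF u(1)])
  define x where "x i = \<psi> i 0 * u 0 + \<psi> i 1 * u 1" for i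
  define y where "y i = \<psi> i 0 * v 0 + \<psi> i 1 * v 1" for i
  \<comment> \<open>The reason for the choice of the quadratic equation.\<close>
  have "x 0 * cnj (y 0) + x 1 * cnj (y 1)
      = G 0 1 * (u 0)\<^sup>2 + (G 1 1 - G 0 0) * u 0 * u 1 - G 1 0 * (u 1)\<^sup>2"
    by (simp add: x_def y_def v_def G_def power2_eq_square algebra_simps)
  with quad have "x 0 * cnj (y 0) + x 1 * cnj (y 1) = 0" by simp
  then obtain e f a b where ef: "orthonormal_pair e f" "0 \<le> a" "0 \<le> b"
    "\<And>i. i < 2 \<Longrightarrow> x i = of_real a * e i" "\<And>i. i < 2 \<Longrightarrow> y i = of_real b * f i"
    using orthogonal_vectors_normalize by metis
  show ?thesis
  proof (rule that[OF ef(1) orthonormal_pair_cnj[OF uv] ef(2,3)])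
    fix i k :: nat assume ik: "i < 2" "k < 2"
    \<comment> \<open>The coefficient matrix is recovered from its values on \<open>u\<close> and
      \<open>v\<close>, so the second Schmidt pair consists of their conjugates.\<close>
    have "of_real a * e i * cnj (u k) + of_real b * f i * cnj (v k) = x i * cnj (u k) + y i * cnj (v k)"
      using ef ik by simp
    also have "\<dots> = \<psi> i 0 * (u 0 * cnj (u k) + v 0 * cnj (v k)) + \<psi> i 1 * (u 1 * cnj (u k) + v 1 * cnj (v k))"
      by (simp add: x_def y_def algebra_simps)
    also have "\<dots> = \<psi> i k"
      using ik by (auto simp: orthonormal_pair_complete[OF uv] less_2_cases_iff)
    finally show "\<psi> i k = of_real a * e i * cnj (u k) + of_real b * f i * cnj (v k)" ..
  qed
qed

text \<open>Cauchy-Schwarz for the plane vectors with coordinates \<open>2 * a * b\<close>,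
  \<open>a\<^sup>2 - b\<^sup>2\<close> and \<open>R\<close>, \<open>- (x + y)\<close>. The first has
  length \<open>a\<^sup>2 + b\<^sup>2\<close>; the second has length at most
  \<open>1 + x * y\<close>, since \<open>(1 - x\<^sup>2) * (1 - y\<^sup>2) + (x + y)\<^sup>2\<close>
  is the square of that number.\<close>

lemma schmidt_balance:
  fixes a b x y R :: real
  assumes ab: "0 \<le> a" "0 \<le> b" and x: "\<bar>x\<bar> \<le> 1" and y: "\<bar>y\<bar> \<le> 1" and R: "R\<^sup>2 \<le> (1 - x\<^sup>2) * (1 - y\<^sup>2)"
  shows "0 \<le> (a\<^sup>2 + b\<^sup>2) * (1 + x * y) + (a\<^sup>2 - b\<^sup>2) * (x + y) - 2 * a * b * R"
proof -
  have "\<bar>x * y\<bar> \<le> 1" using x y by (simp add: abs_mult mult_le_one)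
  then have xy: "0 \<le> 1 + x * y" by linarith
  \<comment> \<open>The added square completes Lagrange's identity.\<close>
  have "(2 * a * b * R - (a\<^sup>2 - b\<^sup>2) * (x + y))\<^sup>2 \<le> (2 * a * b * R - (a\<^sup>2 - b\<^sup>2) * (x + y))\<^sup>2
      + (2 * a * b * (x + y) + (a\<^sup>2 - b\<^sup>2) * R)\<^sup>2" by simp
  also have "\<dots> = (a\<^sup>2 + b\<^sup>2)\<^sup>2 * (R\<^sup>2 + (x + y)\<^sup>2)"
    by (simp add: power2_eq_square algebra_simps)
  also have "\<dots> \<le> (a\<^sup>2 + b\<^sup>2)\<^sup>2 * ((1 - x\<^sup>2) * (1 - y\<^sup>2) + (x + y)\<^sup>2)"
    using R by (intro mult_left_mono add_right_mono) auto
  also have "\<dots> = ((a\<^sup>2 + b\<^sup>2) * (1 + x * y))\<^sup>2"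
    by (simp add: power2_eq_square algebra_simps)
  finally have "\<bar>2 * a * b * R - (a\<^sup>2 - b\<^sup>2) * (x + y)\<bar> \<le> \<bar>(a\<^sup>2 + b\<^sup>2) * (1 + x * y)\<bar>"
    by (simp add: abs_le_square_iff)
  also have "\<dots> = (a\<^sup>2 + b\<^sup>2) * (1 + x * y)" using xy by simp
  finally show ?thesis by linarith
qed

section \<open>Entanglement annihilation\<close>

text \<open>The populations of \<open>e\<close>, \<open>g\<close> and \<open>f\<close>,
  \<open>h\<close> give the terms with indices 0 and 3. The two coherences are adjoint to each
  other, so their mixed terms with indices 1 and 2 cancel, and the square of the imaginary unit
  gives the last sign.\<close>

lemma schmidt_matrix:
  assumes "\<And>i k. i < 2 \<Longrightarrow> k < 2 \<Longrightarrow> \<phi> (i * 2 + k) = of_real a * e i * g k + of_real b * f i * h k"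
  shows "mat (2 * 2) (2 * 2) (\<lambda>(r, c). \<phi> r * cnj (\<phi> c)) = of_real (1 / 4) \<cdot>\<^sub>m
    (of_real (a\<^sup>2 + b\<^sup>2) \<cdot>\<^sub>m tensor_mat (frame e f 0) (frame g h 0)
     + of_real (a\<^sup>2 - b\<^sup>2) \<cdot>\<^sub>m tensor_mat (frame e f 3) (frame g h 0)
     + of_real (a\<^sup>2 - b\<^sup>2) \<cdot>\<^sub>m tensor_mat (frame e f 0) (frame g h 3)
     + of_real (a\<^sup>2 + b\<^sup>2) \<cdot>\<^sub>m tensor_mat (frame e f 3) (frame g h 3)
     + of_real (2 * a * b) \<cdot>\<^sub>m tensor_mat (frame e f 1) (frame g h 1)
     + of_real (- 2 * a * b) \<cdot>\<^sub>m tensor_mat (frame e f 2) (frame g h 2))"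
proof (rule eq_matI, goal_cases)
  case (1 r c)
  then have rc: "r < 2 * 2" "c < 2 * 2" by (simp_all add: frame_def)
  note lt = product_index_div_mod[OF rc(1)] product_index_div_mod[OF rc(2)]
  have \<phi>: "\<phi> r = of_real a * e (r div 2) * g (r mod 2) + of_real b * f (r div 2) * h (r mod 2)"
    "\<phi> c = of_real a * e (c div 2) * g (c mod 2) + of_real b * f (c div 2) * h (c mod 2)"
    using assms[OF lt(1,2)] assms[OF lt(3,4)] by simp_all
  have ten: "tensor_mat (frame e f i) (frame g h j) $$ (r, c)
      = frame e f i $$ (r div 2, c div 2) * frame g h j $$ (r mod 2, c mod 2)" for i j
    by (rule tensor_mat_index[OF frame_carrier frame_carrier rc])
  show ?case
    using rc lt
    by (simp add: carrier_matD[OF frame_carrier] ten \<phi>)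
      (simp add: frame_def power2_eq_square field_simps)
qed (simp_all add: carrier_matD[OF frame_carrier])

lemma tensor_map_pure_sep_cone:
  assumes \<sigma>: "pauli_basis \<sigma>" and F: "linear_superoperator 2 F"
    and F\<sigma>: "\<And>j. j < 4 \<Longrightarrow> F (\<sigma> j) = of_real (\<mu> j) \<cdot>\<^sub>m \<sigma> j" and \<mu>: "\<mu> 0 = 1" "(\<Sum>j\<in>{1..3}. (\<mu> j)\<^sup>2) \<le> 1"
    and \<tau>: "pauli_basis \<tau>" and G: "linear_superoperator 2 G"
    and G\<tau>: "\<And>j. j < 4 \<Longrightarrow> G (\<tau> j) = of_real (\<nu> j) \<cdot>\<^sub>m \<tau> j" and \<nu>: "\<nu> 0 = 1" "(\<Sum>j\<in>{1..3}. (\<nu> j)\<^sup>2) \<le> 1"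
  shows "tensor_map 2 2 F G (mat (2 * 2) (2 * 2) (\<lambda>(r, c). \<phi> r * cnj (\<phi> c))) \<in> sep_cone 2 2"
proof -
  interpret \<sigma>: pauli_basis \<sigma> by fact
  interpret \<tau>: pauli_basis \<tau> by fact
  obtain e f g h a b where ef: "orthonormal_pair e f" and gh: "orthonormal_pair g h"
    and ab: "0 \<le> a" "0 \<le> b"
    and \<phi>: "\<And>i k. i < 2 \<Longrightarrow> k < 2 \<Longrightarrow> \<phi> (i * 2 + k) = of_real a * e i * g k + of_real b * f i * h k"
    using schmidt_decomposition[of "\<lambda>i k. \<phi> (i * 2 + k)"] by metis
  interpret s: pauli_basis "frame e f" by (rule frame_pauli_basis[OF ef])
  interpret t: pauli_basis "frame g h" by (rule frame_pauli_basis[OF gh])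
  define X where "X k = F (frame e f k)" for k
  define Y where "Y k = G (frame g h k)" for k
  have zero: "X 0 = 1\<^sub>m 2" "Y 0 = 1\<^sub>m 2"
    using F\<sigma>[of 0] G\<tau>[of 0] \<mu> \<nu> by (auto simp: X_def Y_def s.zero t.zero \<sigma>.zero \<tau>.zero)
  have carr: "X k \<in> carrier_mat 2 2" "Y k \<in> carrier_mat 2 2" for k
    unfolding X_def Y_def by (rule linear_superoperator_carrier[OF F frame_carrier]
        linear_superoperator_carrier[OF G frame_carrier])+
  have th: "traceless_hermitian (X k)" "traceless_hermitian (Y k)" if "k \<in> {1..3}" for k
    unfolding X_def Y_def
    by (rule \<sigma>.diagonal_map_traceless_hermitian[OF F F\<sigma> s.traceless_hermitian[OF that]]
        \<tau>.diagonal_map_traceless_hermitian[OF G G\<tau> t.traceless_hermitian[OF that]]; assumption)+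
  define x where "x k = bloch_norm (X k)" for k
  define y where "y k = bloch_norm (Y k)" for k
  have nonneg: "0 \<le> x k" "0 \<le> y k" if "k \<in> {1..3}" for k
    unfolding x_def y_def using th[OF that] by (simp_all add: bloch_norm_nonneg)
  have x: "(x 1)\<^sup>2 + (x 2)\<^sup>2 + (x 3)\<^sup>2 \<le> 1"
    using \<sigma>.diagonal_map_norms[OF F F\<sigma> s.pauli_basis_axioms] \<mu>(2)
    unfolding atLeastAtMost_1_3 by (simp add: x_def X_def)
  have y: "(y 1)\<^sup>2 + (y 2)\<^sup>2 + (y 3)\<^sup>2 \<le> 1"
    using \<tau>.diagonal_map_norms[OF G G\<tau> t.pauli_basis_axioms] \<nu>(2)
    unfolding atLeastAtMost_1_3 by (simp add: y_def Y_def)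
  define w where "w = a\<^sup>2 + b\<^sup>2"
  define d where "d = a\<^sup>2 - b\<^sup>2"
  \<comment> \<open>Up to the factor \<open>2 * a * b\<close>, the multiple of the identity lent to
    the two off-diagonal terms.\<close>
  define R where "R = x 1 * y 1 + x 2 * y 2"
  have sq: "(x 3)\<^sup>2 \<le> 1" "(y 3)\<^sup>2 \<le> 1"
    using x y zero_le_power2[of "x 1"] zero_le_power2[of "x 2"] zero_le_power2[of "y 1"] zero_le_power2[of "y 2"]
    by linarith+
  \<comment> \<open>Cauchy-Schwarz over the indices 1 and 2; the norm bounds then leave at most 1
    minus the square at index 3.\<close>
  have "R\<^sup>2 \<le> ((x 1)\<^sup>2 + (x 2)\<^sup>2) * ((y 1)\<^sup>2 + (y 2)\<^sup>2)"
  proof -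
    have "0 \<le> (x 1 * y 2 - x 2 * y 1)\<^sup>2" by simp
    then show ?thesis by (simp add: R_def power2_eq_square algebra_simps)
  qed
  also have "\<dots> \<le> (1 - (x 3)\<^sup>2) * (1 - (y 3)\<^sup>2)"
    using x y sq by (intro mult_mono) (auto intro: add_nonneg_nonneg)
  finally have R: "R\<^sup>2 \<le> (1 - (x 3)\<^sup>2) * (1 - (y 3)\<^sup>2)" .
  have le1: "\<bar>x 3\<bar> \<le> 1" "\<bar>y 3\<bar> \<le> 1"
    using sq by (simp_all add: abs_square_le_1)
  \<comment> \<open>The four choices of signs give the eigenvalues of the diagonal
    remainder.\<close>
  have balance: "0 \<le> w * (1 + u * v) + d * (u + v) - 2 * a * b * R"
    if "u = x 3 \<or> u = - x 3" "v = y 3 \<or> v = - y 3" for u v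
    unfolding w_def d_def by (rule schmidt_balance[OF ab]) (use that le1 R in auto)
  let ?T = "tensor_map 2 2 F G"
  have lin: "linear_superoperator (2 * 2) ?T" by (rule linear_superoperator_tensor_map)
  have T: "?T (tensor_mat (frame e f i) (frame g h j)) = tensor_mat (X i) (Y j)" for i j
    unfolding X_def Y_def by (rule tensor_map_tensor_mat[OF F G frame_carrier frame_carrier])
  have Tadd: "?T (A + B) = ?T A + ?T B" if "A \<in> carrier_mat (2 * 2) (2 * 2)" "B \<in> carrier_mat (2 * 2) (2 * 2)" for A B
    using lin that unfolding linear_superoperator_def by blast
  have Tsmult: "?T (z \<cdot>\<^sub>m A) = z \<cdot>\<^sub>m ?T A" if "A \<in> carrier_mat (2 * 2) (2 * 2)" for z A
    using lin that unfolding linear_superoperator_def by blast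
  have tc: "tensor_mat (frame e f i) (frame g h j) \<in> carrier_mat (2 * 2) (2 * 2)" for i j
    by (rule tensor_mat_carrier[OF frame_carrier frame_carrier])
  have "?T (mat (2 * 2) (2 * 2) (\<lambda>(r, c). \<phi> r * cnj (\<phi> c))) = of_real (1 / 4) \<cdot>\<^sub>m
    (of_real w \<cdot>\<^sub>m tensor_mat (1\<^sub>m 2) (1\<^sub>m 2) + of_real d \<cdot>\<^sub>m tensor_mat (X 3) (1\<^sub>m 2)
     + of_real d \<cdot>\<^sub>m tensor_mat (1\<^sub>m 2) (Y 3) + of_real w \<cdot>\<^sub>m tensor_mat (X 3) (Y 3)
     + of_real (2 * a * b) \<cdot>\<^sub>m tensor_mat (X 1) (Y 1) + of_real (- 2 * a * b) \<cdot>\<^sub>m tensor_mat (X 2) (Y 2))"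
  proof (subst schmidt_matrix[of \<phi> a e g b f h], goal_cases)
    case (1 i k)
    then show ?case by (rule \<phi>)
  next
    case 2
    show ?case
      unfolding w_def[symmetric] d_def[symmetric]
      by (simp only: Tadd Tsmult T tc zero smult_carrier_mat add_carrier_mat)
  qed
  \<comment> \<open>The loan is split between the two off-diagonal terms. Zero coefficients bring
    every group into the shape of \<open>sep_cone_diagonal\<close>.\<close>
  also have "\<dots> = of_real (1 / 4) \<cdot>\<^sub>m
    ((of_real (w - 2 * a * b * R) \<cdot>\<^sub>m tensor_mat (1\<^sub>m 2) (1\<^sub>m 2) + of_real d \<cdot>\<^sub>m tensor_mat (X 3) (1\<^sub>m 2)
       + of_real d \<cdot>\<^sub>m tensor_mat (1\<^sub>m 2) (Y 3) + of_real w \<cdot>\<^sub>m tensor_mat (X 3) (Y 3))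
     + (of_real (2 * a * b * (x 1 * y 1)) \<cdot>\<^sub>m tensor_mat (1\<^sub>m 2) (1\<^sub>m 2) + of_real 0 \<cdot>\<^sub>m tensor_mat (X 1) (1\<^sub>m 2)
       + of_real 0 \<cdot>\<^sub>m tensor_mat (1\<^sub>m 2) (Y 1) + of_real (2 * a * b) \<cdot>\<^sub>m tensor_mat (X 1) (Y 1))
     + (of_real (2 * a * b * (x 2 * y 2)) \<cdot>\<^sub>m tensor_mat (1\<^sub>m 2) (1\<^sub>m 2) + of_real 0 \<cdot>\<^sub>m tensor_mat (X 2) (1\<^sub>m 2)
       + of_real 0 \<cdot>\<^sub>m tensor_mat (1\<^sub>m 2) (Y 2) + of_real (- 2 * a * b) \<cdot>\<^sub>m tensor_mat (X 2) (Y 2)))"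
    by (rule eq_matI) (simp_all add: carrier_matD[OF carr(1)] carrier_matD[OF carr(2)] R_def algebra_simps)
  also have "\<dots> \<in> sep_cone 2 2"
  proof (rule sep_cone_smult, rule sep_cone_add, rule sep_cone_add, goal_cases)
    case 1
    show ?case
    proof (rule sep_cone_diagonal, goal_cases)
      case 3
      show ?case using balance[of "x 3" "y 3"] by (simp add: x_def y_def algebra_simps)
    next
      case 4
      show ?case using balance[of "x 3" "- y 3"] by (simp add: x_def y_def algebra_simps)
    next
      case 5
      show ?case using balance[of "- x 3" "y 3"] by (simp add: x_def y_def algebra_simps)
    next
      case 6
      show ?case using balance[of "- x 3" "- y 3"] by (simp add: x_def y_def algebra_simps)
    qed (simp_all add: th)
  next
    \<comment> \<open>The loan exactly covers the term: two of the four eigenvalues are 0 and the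
      other two are \<open>4 * a * b * (x 1 * y 1)\<close>.\<close>
    case 2
    show ?case
      using ab nonneg[of 1] by (intro sep_cone_diagonal th) (simp_all add: x_def y_def)
  next
    case 3
    show ?case
      using ab nonneg[of 2] by (intro sep_cone_diagonal th) (simp_all add: x_def y_def)
  qed simp
  finally show ?thesis .
qed

lemma tensor_map_sep_cone:
  assumes "pauli_basis \<sigma>" "linear_superoperator 2 F"
    "\<And>j. j < 4 \<Longrightarrow> F (\<sigma> j) = of_real (\<mu> j) \<cdot>\<^sub>m \<sigma> j" "\<mu> 0 = 1" "(\<Sum>j\<in>{1..3}. (\<mu> j)\<^sup>2) \<le> 1"
    and "pauli_basis \<tau>" "linear_superoperator 2 G"
    "\<And>j. j < 4 \<Longrightarrow> G (\<tau> j) = of_real (\<nu> j) \<cdot>\<^sub>m \<tau> j" "\<nu> 0 = 1" "(\<Sum>j\<in>{1..3}. (\<nu> j)\<^sup>2) \<le> 1"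
    and \<rho>: "positive_semidefinite (2 * 2) \<rho>"
  shows "tensor_map 2 2 F G \<rho> \<in> sep_cone 2 2"
proof -
  let ?T = "tensor_map 2 2 F G"
  have c: "\<rho> \<in> carrier_mat (2 * 2) (2 * 2)" and P: "psd_kernel {..<2 * 2} (\<lambda>r c. \<rho> $$ (r, c))"
    using \<rho> by (auto simp: positive_semidefinite_iff)
  obtain V where V: "\<And>r c. r \<in> {..<2 * 2} \<Longrightarrow> c \<in> {..<2 * 2} \<Longrightarrow> \<rho> $$ (r, c) = (\<Sum>k\<in>{..<2 * 2::nat}. V k r * cnj (V k c))"
    using psd_kernel_decompose[OF finite_lessThan P] by blast
  define M where "M k = mat (2 * 2) (2 * 2) (\<lambda>(r, c). V k r * cnj (V k c))" for k :: nat
  \<comment> \<open>The factor 1 is the coefficient expected by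
    \<open>linear_superoperator_sum\<close>.\<close>
  have "\<rho> = mat (2 * 2) (2 * 2) (\<lambda>ij. \<Sum>k<2 * 2. 1 * M k $$ ij)"
    using c V by (intro eq_matI) (auto simp: M_def)
  then have "?T \<rho> = ?T (mat (2 * 2) (2 * 2) (\<lambda>ij. \<Sum>k<2 * 2. 1 * M k $$ ij))" by (rule arg_cong)
  also have "\<dots> = mat (2 * 2) (2 * 2) (\<lambda>ij. \<Sum>k<2 * 2. 1 * ?T (M k) $$ ij)"
    by (rule linear_superoperator_sum[OF linear_superoperator_tensor_map]) (simp_all add: M_def)
  also have "\<dots> = mat (2 * 2) (2 * 2) (\<lambda>ij. \<Sum>k<2 * 2. ?T (M k) $$ ij)" by (simp only: mult_1_left)
  also have "\<dots> \<in> sep_cone 2 2"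
    unfolding M_def by (intro sep_cone_sum finite_lessThan tensor_map_pure_sep_cone[OF assms(1-10)])
  finally show ?thesis .
qed

section \<open>From the channel hypotheses to the theorem\<close>

text \<open>The value \<open>l 0\<close> is arbitrary; overwriting it by 1 gives one diagonal
  equation for all four basis elements.\<close>

lemma pauli_diagonalE:
  assumes "pauli_diagonal F l"
  obtains \<sigma> where "pauli_basis \<sigma>" "\<And>j. j < 4 \<Longrightarrow> F (\<sigma> j) = of_real ((l(0 := 1)) j) \<cdot>\<^sub>m \<sigma> j"
proof -
  obtain \<sigma> where \<sigma>: "pauli_type_basis \<sigma>" "F (\<sigma> 0) = \<sigma> 0" "\<forall>m\<in>{1..3}. F (\<sigma> m) = complex_of_real (l m) \<cdot>\<^sub>m \<sigma> m"
    using assms by (auto simp: pauli_diagonal_def)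
  have "F (\<sigma> j) = of_real ((l(0 := 1)) j) \<cdot>\<^sub>m \<sigma> j" if "j < 4" for j
  proof (cases "j = 0")
    case True
    have "1 \<cdot>\<^sub>m \<sigma> 0 = \<sigma> 0" by (intro eq_matI) auto
    with True \<sigma>(2) show ?thesis by simp
  next
    case False
    with that \<sigma>(3) show ?thesis by simp
  qed
  with \<sigma>(1) show ?thesis by (intro that) (auto simp: pauli_basis_def)
qed

text \<open>Squaring the channel squares its diagonal entries, so they are nonnegative as
  \<open>entanglement_breaking_if_sum_le\<close> demands. The entry 1 at index 0 turns the bound 2
  of the converse into 1.\<close>

lemma entanglement_breaking_square_iff:
  assumes ch: "quantum_channel 2 F" and diag: "pauli_diagonal F l"
  shows "entanglement_breaking 2 (F \<circ> F) \<longleftrightarrow> (\<Sum>m\<in>{1..3}. (l m)\<^sup>2) \<le> 1"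
proof -
  let ?m = "l(0 := 1)"
  obtain \<sigma> where "pauli_basis \<sigma>" and \<sigma>: "\<And>j. j < 4 \<Longrightarrow> F (\<sigma> j) = of_real (?m j) \<cdot>\<^sub>m \<sigma> j"
    using pauli_diagonalE[OF diag] by blast
  interpret pauli_basis \<sigma> by fact
  have FF: "(F \<circ> F) (\<sigma> j) = of_real ((?m j)\<^sup>2) \<cdot>\<^sub>m \<sigma> j" if "j < 4" for j
  proof -
    have "F (of_real (?m j) \<cdot>\<^sub>m \<sigma> j) = of_real (?m j) \<cdot>\<^sub>m F (\<sigma> j)"
      using ch carrier[OF that] unfolding quantum_channel_def linear_superoperator_def by blast
    also have "\<dots> = of_real ((?m j)\<^sup>2) \<cdot>\<^sub>m \<sigma> j"
      unfolding \<sigma>[OF that] by (intro eq_matI) (simp_all add: power2_eq_square)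
    finally show ?thesis by (simp only: comp_apply \<sigma>[OF that])
  qed
  have sum: "(\<Sum>m\<in>{1..3}. (?m m)\<^sup>2) = (\<Sum>m\<in>{1..3}. (l m)\<^sup>2)" by (intro sum.cong) auto
  show ?thesis
  proof
    assume "entanglement_breaking 2 (F \<circ> F)"
    from entanglement_breaking_imp_sum_le[OF this FF] show "(\<Sum>m\<in>{1..3}. (l m)\<^sup>2) \<le> 1"
      unfolding sum_lessThan_4_split sum by simp
  next
    assume "(\<Sum>m\<in>{1..3}. (l m)\<^sup>2) \<le> 1"
    then show "entanglement_breaking 2 (F \<circ> F)"
      by (intro entanglement_breaking_if_sum_le[OF quantum_channel_comp[OF ch ch] FF]) (simp_all only: sum, simp_all)
  qed
qed

text \<open>The equivalences are part of the conclusion, so the annihilation claim is available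
  under either form of the hypothesis.\<close>

theorem proposition1:
  fixes E1 E2 :: "complex mat \<Rightarrow> complex mat" and l l' :: "nat \<Rightarrow> real"
  assumes "unital_channel 2 E1" and "pauli_diagonal E1 l"
    and "unital_channel 2 E2" and "pauli_diagonal E2 l'"
  shows "(entanglement_breaking 2 (E1 \<circ> E1) \<longleftrightarrow> (\<Sum>m\<in>{1..3}. (l m)\<^sup>2) \<le> 1) \<and>
         (entanglement_breaking 2 (E2 \<circ> E2) \<longleftrightarrow> (\<Sum>n\<in>{1..3}. (l' n)\<^sup>2) \<le> 1) \<and>
         (entanglement_breaking 2 (E1 \<circ> E1) \<and> entanglement_breaking 2 (E2 \<circ> E2) \<longrightarrow>
            entanglement_annihilating 2 2 (tensor_map 2 2 E1 E2))"
proof (intro conjI impI)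
  have ch: "quantum_channel 2 E1" "quantum_channel 2 E2"
    using assms(1,3) by (auto simp: unital_channel_def)
  show iff1: "entanglement_breaking 2 (E1 \<circ> E1) \<longleftrightarrow> (\<Sum>m\<in>{1..3}. (l m)\<^sup>2) \<le> 1"
    by (rule entanglement_breaking_square_iff[OF ch(1) assms(2)])
  show iff2: "entanglement_breaking 2 (E2 \<circ> E2) \<longleftrightarrow> (\<Sum>n\<in>{1..3}. (l' n)\<^sup>2) \<le> 1"
    by (rule entanglement_breaking_square_iff[OF ch(2) assms(4)])
  assume "entanglement_breaking 2 (E1 \<circ> E1) \<and> entanglement_breaking 2 (E2 \<circ> E2)"
  then have le: "(\<Sum>m\<in>{1..3}. (l m)\<^sup>2) \<le> 1" "(\<Sum>n\<in>{1..3}. (l' n)\<^sup>2) \<le> 1"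
    using iff1 iff2 by auto
  obtain \<sigma> where \<sigma>: "pauli_basis \<sigma>" "\<And>j. j < 4 \<Longrightarrow> E1 (\<sigma> j) = of_real ((l(0 := 1)) j) \<cdot>\<^sub>m \<sigma> j"
    using pauli_diagonalE[OF assms(2)] by blast
  obtain \<tau> where \<tau>: "pauli_basis \<tau>" "\<And>j. j < 4 \<Longrightarrow> E2 (\<tau> j) = of_real ((l'(0 := 1)) j) \<cdot>\<^sub>m \<tau> j"
    using pauli_diagonalE[OF assms(4)] by blast
  have lin: "linear_superoperator 2 E1" "linear_superoperator 2 E2"
    using ch by (auto simp: quantum_channel_def)
  have sum: "(\<Sum>m\<in>{1..3}. ((k(0 := 1)) m)\<^sup>2) = (\<Sum>m\<in>{1..3}. (k m)\<^sup>2)" for k :: "nat \<Rightarrow> real"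
    by (intro sum.cong) auto
  have channel: "quantum_channel (2 * 2) (tensor_map 2 2 E1 E2)"
    by (rule quantum_channel_tensor_map[OF ch])
  show "entanglement_annihilating 2 2 (tensor_map 2 2 E1 E2)"
    unfolding entanglement_annihilating_def
  proof (intro conjI allI impI channel)
    fix \<rho> assume \<rho>: "quantum_state (2 * 2) \<rho>"
    then have "tensor_map 2 2 E1 E2 \<rho> \<in> sep_cone 2 2"
      using le by (intro tensor_map_sep_cone[OF \<sigma>(1) lin(1) \<sigma>(2) _ _ \<tau>(1) lin(2) \<tau>(2)])
        (simp_all only: sum quantum_state_def, simp_all)
    moreover have "mat_trace (tensor_map 2 2 E1 E2 \<rho>) = 1"
      using channel \<rho> positive_semidefinite_carrier[of "2 * 2" \<rho>]
      by (simp add: quantum_channel_def trace_preserving_def quantum_state_def)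
    ultimately show "separable 2 2 (tensor_map 2 2 E1 E2 \<rho>)" by (rule separable_if_sep_cone)
  qed
qed

end
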